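(* Let $\nu$ be the uniform Bernoulli measure on $\mathcal{C}^{\mathbb{N}}$ given by $\nu(j)=\frac1m$, $\eta$ the uniform Bernoulli measure on $\mathcal{I}^{\mathbb{N}}$ given by $\eta(i)=\frac12$, and $\ell$ the normalized Lebesgue measure on $X$. The probability measure $\mu$ on $X\times\mathbb{R}\times\mathcal{C}^{\mathbb{N}}$ given by $$\int_{X\times\mathbb{R}\times\mathcal{C}^{\mathbb{N}}} g(x,y,\bar b)\,d\mu(x,y,\bar b)=\int_{X\times\mathcal{I}^{\mathbb{N}}\times\mathcal{C}^{\mathbb{N}}\times\mathcal{C}^{\mathbb{N}}} g(\Psi(x,\bar a,\bar c,\bar b))\,d\ell(x)\,d\eta(\bar a)\,d\nu(\bar c)\,d\nu(\bar b),$$ that is, the push-forward of $\ell\times\eta\times\nu\times\nu$ under $\Psi$, is ergodic with respect to $G$. In particular, there exists a set $\Omega\subseteq X\times\mathbb{R}\times\mathcal{C}^{\mathbb{N}}$ with $\mu(\Omega)=1$ such that, for all $(x,y,\bar b)\in\Omega$, $$\frac1N\sum_{j=0}^{N-1}g(G^j(x,y,\bar b))\longrightarrow\int_{X\times\mathbb{R}\times\mathcal{C}^{\mathbb{N}}} g(x,y,\bar b)\,d\mu(x,y,\bar b)\quad\text{as }N\to\infty,$$ for all $g\in L^1(\mu)$. (This measure $\mu$ is called the random SRB measure for the IFS $(X\times\mathbb{R},G_c)_{c\in\mathcal{C}}$.)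
   Context: $X=\mathbb{R}/\mathbb{Z}$, $T:X\to X$ is the doubling map $T(x)=2x$, $0<\lambda<1$ is fixed, $\mathcal{C}=\{0,\dots,m-1\}$ with $m\ge 2$, $\mathcal{I}=\{0,1\}$, and $A_c:X\to\mathbb{R}$ ($c\in\mathcal{C}$) are Lipschitz functions. $G_c(x,y)=(T(x),A_c(x)+\lambda y)$ on $X\times\mathbb{R}$. $\tau_i(x)=\frac12x+\frac i2$ (with $x\in[0,1)$ as representative), $i\in\mathcal{I}$, are the inverse branches of $T$. For $\bar c=(c_0,c_1,\dots)\in\mathcal{C}^{\mathbb{N}}$ and $\bar a=(a_0,a_1,\dots)\in\mathcal{I}^{\mathbb{N}}$, $$S_x(\bar c,\bar a)=\sum_{i=0}^\infty\lambda^iA_{c_i}(\tau_{a_i}\circ\cdots\circ\tau_{a_0}(x)).$$ Sequences $\bar b\in\mathcal{C}^{\mathbb{N}}$ in the last coordinate are indexed as $\bar b=(b_{-1},b_{-2},\dots)$, with shift $\sigma\bar b=(b_{-2},b_{-3},\dots)$. The map $G:X\times\mathbb{R}\times\mathcal{C}^{\mathbb{N}}\to X\times\mathbb{R}\times\mathcal{C}^{\mathbb{N}}$ is $G(x,y,\bar b)=(G_{b_{-1}}(x,y),\sigma\bar b)=(T(x),A_{b_{-1}}(x)+\lambda y,\sigma\bar b)$. The map $\Psi:X\times\mathcal{I}^{\mathbb{N}}\times\mathcal{C}^{\mathbb{N}}\times\mathcal{C}^{\mathbb{N}}\to X\times\mathbb{R}\times\mathcal{C}^{\mathbb{N}}$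 is $\Psi(x,\bar a,\bar c,\bar b)=(x,S_x(\bar c,\bar a),\bar b)$. Sequence spaces carry the product topology.
   Formalization: A single Ω for all g in L^1(μ) is impossible since μ has no atoms (take the indicator of a point's forward orbit); proved instead: for each g in L^1(μ) a full-measure Ω depending on g, and one full-measure Ω serving all continuous g in L^1(μ). *)

theory Defs
  imports "HOL-Probability.Probability"
begin

section \<open>The circle\<close>

quotient_type circle = real / "\<lambda>x y::real. x - y \<in> \<int>"
  morphisms circle_repset circle_proj
proof (rule equivpI)
  show "reflp (\<lambda>x y::real. x - y \<in> \<int>)"
    by (simp add: reflp_def)
  show "symp (\<lambda>x y::real. x - y \<in> \<int>)"
    by (intro sympI) (metis Ints_minus minus_diff_eq)
  show "transp (\<lambda>x y::real. x - y \<in> \<int>)"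
  proof (intro transpI)
    fix x y z :: real assume "x - y \<in> \<int>" "y - z \<in> \<int>"
    then have "(x - y) + (y - z) \<in> \<int>" by (rule Ints_add)
    then show "x - z \<in> \<int>" by simp
  qed
qed

lemma infdist_Ints_attained:
  obtains k where "k \<in> \<int>" "infdist (x::real) \<int> = \<bar>x - k\<bar>"
proof -
  have "\<int> \<noteq> ({}::real set)" using Ints_0 by blast
  then obtain k where "k \<in> \<int>" "infdist x \<int> = dist x k"
    using infdist_attains_inf[OF closed_Ints] by blast
  then show ?thesis using that by (simp add: dist_real_def)
qed

lemma infdist_Ints_le: "k \<in> \<int> \<Longrightarrow> infdist (x::real) \<int> \<le> \<bar>x - k\<bar>"
  using infdist_le[of k "\<int>" x] by (simp add: dist_real_def)

lemma infdist_Ints_add_le: "infdist (x + y::real) \<int> \<le> infdist x \<int> + infdist y \<int>"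
proof -
  obtain k l where k: "k \<in> \<int>" "infdist x \<int> = \<bar>x - k\<bar>" and l: "l \<in> \<int>" "infdist y \<int> = \<bar>y - l\<bar>"
    by (metis infdist_Ints_attained)
  have "infdist (x + y) \<int> \<le> \<bar>x + y - (k + l)\<bar>"
    using k l by (intro infdist_Ints_le Ints_add)
  then show ?thesis using k l by linarith
qed

lemma infdist_Ints_minus_le: "infdist (- x::real) \<int> \<le> infdist x \<int>"
proof -
  obtain k where k: "k \<in> \<int>" "infdist x \<int> = \<bar>x - k\<bar>"
    by (rule infdist_Ints_attained)
  have "infdist (- x) \<int> \<le> \<bar>- x - (- k)\<bar>"
    using k by (intro infdist_Ints_le Ints_minus)
  then show ?thesis using k by linarith
qed

lemma infdist_Ints_minus: "infdist (- x::real) \<int> = infdist x \<int>"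
  using infdist_Ints_minus_le[of x] infdist_Ints_minus_le[of "- x"] by simp

lemma infdist_Ints_cong:
  assumes "x - y \<in> \<int>"
  shows "infdist (x::real) \<int> = infdist y \<int>"
proof -
  have "infdist (x - y) \<int> = 0" using assms by simp
  moreover have "infdist (y - x) \<int> = 0"
    using infdist_Ints_minus[of "x - y"] assms by simp
  ultimately show ?thesis
    using infdist_Ints_add_le[of "x - y" y] infdist_Ints_add_le[of "y - x" x] by simp
qed

instantiation circle :: metric_space
begin

text \<open>The quotient metric: the distance of \<open>x - y\<close> to the nearest integer.\<close>

lift_definition dist_circle :: "circle \<Rightarrow> circle \<Rightarrow> real" is "\<lambda>x y. infdist (x - y) \<int>"
proof -
  fix x x' y y' :: real assume "x - x' \<in> \<int>" "y - y' \<in> \<int>"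
  then have "(x - x') - (y - y') \<in> \<int>" by (rule Ints_diff)
  then have "(x - y) - (x' - y') \<in> \<int>" by (simp add: algebra_simps)
  then show "infdist (x - y) \<int> = infdist (x' - y') \<int>" by (rule infdist_Ints_cong)
qed

definition uniformity_circle :: "(circle \<times> circle) filter" where
  "uniformity_circle = (INF e\<in>{0<..}. principal {(x, y). dist x y < e})"

definition open_circle :: "circle set \<Rightarrow> bool" where
  "open_circle U = (\<forall>x\<in>U. eventually (\<lambda>(x', y). x' = x \<longrightarrow> y \<in> U) uniformity)"

instance
proof
  fix x y z :: circle
  show "dist x y = 0 \<longleftrightarrow> x = y"
  proof (transfer)
    fix x y :: real
    have "\<int> \<noteq> ({}::real set)" using Ints_0 by blast
    then show "infdist (x - y) \<int> = 0 \<longleftrightarrow> x - y \<in> \<int>"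
      using in_closed_iff_infdist_zero[OF closed_Ints] by blast
  qed
  show "dist x y \<le> dist x z + dist y z"
  proof (transfer)
    fix x y z :: real
    show "infdist (x - y) \<int> \<le> infdist (x - z) \<int> + infdist (y - z) \<int>"
      using infdist_Ints_add_le[of "x - z" "z - y"] infdist_Ints_minus[of "y - z"] by simp
  qed
qed (rule uniformity_circle_def open_circle_def)+

end

text \<open>The representative in \<open>[0,1)\<close>.\<close>

lift_definition circle_rep :: "circle \<Rightarrow> real" is frac
proof -
  fix x y :: real assume "x - y \<in> \<int>"
  then obtain k where "x - y = of_int k" by (elim Ints_cases)
  then have "x = y + of_int k" by simp
  then show "frac x = frac y" by (simp add: frac_def)
qed

lift_definition doubling :: "circle \<Rightarrow> circle" is "\<lambda>x. 2 * x"
proof -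
  fix x y :: real assume "x - y \<in> \<int>"
  then have "(x - y) + (x - y) \<in> \<int>" by (intro Ints_add)
  then show "2 * x - 2 * y \<in> \<int>" by (simp add: algebra_simps)
qed

definition inv_branch :: "nat \<Rightarrow> circle \<Rightarrow> circle" where
  "inv_branch i x = circle_proj (circle_rep x / 2 + real i / 2)"

definition circle_lebesgue :: "circle measure" where
  "circle_lebesgue = distr (uniform_measure lborel {0..<1}) borel circle_proj"

section \<open>The skew product and the random SRB measure\<close>

text \<open>
  The alphabet with \<open>m\<close> letters is \<open>{..<m}\<close>, and a sequence over it is a function
  \<open>nat \<Rightarrow> nat\<close> with values in \<open>{..<m}\<close>; this is exactly the space of the measure below.
\<close>

definition bernoulli_uniform :: "nat \<Rightarrow> (nat \<Rightarrow> nat) measure" where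
  "bernoulli_uniform m = (\<Pi>\<^sub>M i\<in>(UNIV :: nat set). uniform_count_measure {..<m})"

text \<open>\<open>inv_word a n\<close> is the composition of the \<open>n\<close> branches \<open>a 0, \<dots>, a (n - 1)\<close>,
  with \<open>a 0\<close> applied first.\<close>

primrec inv_word :: "(nat \<Rightarrow> nat) \<Rightarrow> nat \<Rightarrow> circle \<Rightarrow> circle" where
  "inv_word a 0 x = x"
| "inv_word a (Suc n) x = inv_branch (a n) (inv_word a n x)"

definition S_sum :: "(nat \<Rightarrow> circle \<Rightarrow> real) \<Rightarrow> real \<Rightarrow> circle \<Rightarrow> (nat \<Rightarrow> nat) \<Rightarrow> (nat \<Rightarrow> nat) \<Rightarrow> real" where
  "S_sum A l x c a = (\<Sum>i. l ^ i * A (c i) (inv_word a (Suc i) x))"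

text \<open>A sequence \<open>(b\<^bsub>-1\<^esub>, b\<^bsub>-2\<^esub>, \<dots>)\<close> is represented by \<open>b\<close> with \<open>b k\<close> standing for
  \<open>b\<^bsub>-(k+1)\<^esub>\<close>.\<close>

definition skew ::
  "(nat \<Rightarrow> circle \<Rightarrow> real) \<Rightarrow> real \<Rightarrow> circle \<times> real \<times> (nat \<Rightarrow> nat) \<Rightarrow> circle \<times> real \<times> (nat \<Rightarrow> nat)" where
  "skew A l = (\<lambda>(x, y, b). (doubling x, A (b 0) x + l * y, \<lambda>k. b (Suc k)))"

definition Psi ::
  "(nat \<Rightarrow> circle \<Rightarrow> real) \<Rightarrow> real \<Rightarrow>
    circle \<times> (nat \<Rightarrow> nat) \<times> (nat \<Rightarrow> nat) \<times> (nat \<Rightarrow> nat) \<Rightarrow> circle \<times> real \<times> (nat \<Rightarrow> nat)" where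
  "Psi A l = (\<lambda>(x, a, c, b). (x, S_sum A l x c a, b))"

text \<open>The Borel sigma-algebra on sequences is the product one (the alphabet is finite), so the
  target below carries the Borel sigma-algebra of the product topology.\<close>

definition random_SRB ::
  "nat \<Rightarrow> (nat \<Rightarrow> circle \<Rightarrow> real) \<Rightarrow> real \<Rightarrow> (circle \<times> real \<times> (nat \<Rightarrow> nat)) measure" where
  "random_SRB m A l =
    distr (circle_lebesgue \<Otimes>\<^sub>M bernoulli_uniform 2 \<Otimes>\<^sub>M bernoulli_uniform m \<Otimes>\<^sub>M bernoulli_uniform m)
      (borel \<Otimes>\<^sub>M borel \<Otimes>\<^sub>M bernoulli_uniform m)
      (Psi A l)"

section \<open>Ergodicity\<close>

definition measure_preserving_map :: "'a measure \<Rightarrow> ('a \<Rightarrow> 'a) \<Rightarrow> bool" where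
  "measure_preserving_map M f \<longleftrightarrow> f \<in> M \<rightarrow>\<^sub>M M \<and> distr M M f = M"

definition ergodic :: "'a measure \<Rightarrow> ('a \<Rightarrow> 'a) \<Rightarrow> bool" where
  "ergodic M f \<longleftrightarrow> measure_preserving_map M f \<and>
    (\<forall>E\<in>sets M. f -` E \<inter> space M = E \<longrightarrow> measure M E = 0 \<or> measure M E = 1)"

definition birkhoff_avg :: "('a \<Rightarrow> 'a) \<Rightarrow> ('a \<Rightarrow> real) \<Rightarrow> nat \<Rightarrow> 'a \<Rightarrow> real" where
  "birkhoff_avg f g N w = (1 / real N) * (\<Sum>j<N. g ((f ^^ j) w))"

end

theory Submission
  imports Defs
begin

text \<open>
The skew product is a factor of a Bernoulli shift.  Record, next to a point \<open>x\<close> of the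
circle and a future word \<open>b\<close>, the two pasts: the branches \<open>a\<close> through
which \<open>x\<close> is reached and the letters \<open>c\<close> that were read before
\<open>b\<close>.  One step of the dynamics moves the leading binary digit of \<open>x\<close> to
the front of \<open>a\<close> and the first letter of \<open>b\<close> to the front of
\<open>c\<close>: on \<open>(a, x)\<close> this is the baker's map, on \<open>(c, b)\<close> the
two-sided shift.  With \<open>i\<close> for the leading digit of \<open>x\<close> and
\<open>k\<close> for the first letter of \<open>b\<close>, the defining series \<open>S\<close>
satisfies \<open>S (T x) (k c) (i a) = A k x + l * S x c a\<close> (\<open>S_sum_doubling\<close>),
so \<open>\<Psi>\<close> carries this map to the skew product, and \<open>\<mu>\<close> is the image
of the product measure.  Hence \<open>\<mu>\<close> is invariant, and it inherits mixing, which is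
stronger than ergodicity.

Mixing is established upstairs.  A Dynkin argument (\<open>mixing_from_generator\<close>) reduces it
to a generating \<open>\<inter>\<close>-stable family; for the two-sided shift in the form (past,
future) the family of boxes works, because the shifted box eventually constrains other coordinates
than the fixed one (\<open>two_sided_shift_mixing\<close>).  The baker's map becomes this shift when
a point of the circle is replaced by its binary digits, which are independent fair bits under
Lebesgue measure (\<open>distr_binary_digits\<close>) and determine the point
(\<open>from_binary_digits_inverse\<close>), so \<open>baker_mixing\<close> follows; products and
factors of mixing maps are mixing.

The averages of a single integrable function converge almost everywhere by Birkhoff's theorem, which
is derived from the maximal ergodic inequality.  For an exceptional set that serves all continuous
functions simultaneously, almost every orbit stays in a compact attractor, since the fibre
coordinate of a typical point is at most \<open>C / (1 - l)\<close> in absolute value when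
\<open>C\<close> bounds all \<open>\<bar>A c x\<bar>\<close>.  The attractor is cut into finitely
many cells at every scale; at a point that has the right frequencies for each of these countably
many cells, a continuous function is uniformly approximated by functions that are constant on cells,
and its averages converge as well (\<open>birkhoff_continuous\<close>).
\<close>

section \<open>Measure-preserving maps\<close>

lemma measurable_funpow:
  assumes "f \<in> M \<rightarrow>\<^sub>M M"
  shows "f ^^ n \<in> M \<rightarrow>\<^sub>M M"
proof (induction n)
  case (Suc n)
  show ?case unfolding funpow.simps by (rule measurable_comp[OF Suc assms])
qed (simp add: id_def)

lemma vimage_funpow_Int_sets:
  assumes "f \<in> M \<rightarrow>\<^sub>M M" "A \<in> sets M" "B \<in> sets M"
  shows "(f ^^ n) -` A \<inter> B \<in> sets M"
proof -
  have "(f ^^ n) -` A \<inter> B = ((f ^^ n) -` A \<inter> space M) \<inter> B"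
    using sets.sets_into_space[OF assms(3)] by blast
  then show ?thesis
    using measurable_sets[OF measurable_funpow[OF assms(1)] assms(2)] assms(3) by simp
qed

lemma measure_preserving_mapD:
  assumes "measure_preserving_map M f" "A \<in> sets M"
  shows "measure M (f -` A \<inter> space M) = measure M A"
  using assms measure_distr[of f M M A] by (simp add: measure_preserving_map_def)

lemma measure_preserving_map_funpow:
  assumes "measure_preserving_map M f"
  shows "measure_preserving_map M (f ^^ n)"
proof (induction n)
  case 0
  show ?case by (simp add: measure_preserving_map_def id_def distr_id)
next
  case (Suc n)
  have m: "f \<in> M \<rightarrow>\<^sub>M M" "f ^^ n \<in> M \<rightarrow>\<^sub>M M"
    and e: "distr M M f = M" "distr M M (f ^^ n) = M"
    using assms Suc by (auto simp: measure_preserving_map_def)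
  have "distr M M (f \<circ> f ^^ n) = distr (distr M M (f ^^ n)) M f"
    by (rule distr_distr[symmetric]) (use m in auto)
  moreover have "f \<circ> f ^^ n \<in> M \<rightarrow>\<^sub>M M" by (rule measurable_comp[OF m(2,1)])
  ultimately show ?case using e by (simp only: measure_preserving_map_def funpow.simps)
qed

lemma measure_preserving_map_integral:
  fixes g :: "'a \<Rightarrow> real"
  assumes "measure_preserving_map M f" "integrable M g"
  shows "integrable M (\<lambda>w. g (f w))" "(\<integral>w. g (f w) \<partial>M) = integral\<^sup>L M g"
proof -
  have m: "f \<in> M \<rightarrow>\<^sub>M M" "distr M M f = M" "g \<in> borel_measurable M"
    using assms by (auto simp: measure_preserving_map_def)
  show "integrable M (\<lambda>w. g (f w))"
    using integrable_distr_eq[of f M M g] m assms by simp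
  show "(\<integral>w. g (f w) \<partial>M) = integral\<^sup>L M g"
    using integral_distr[of f M M g] m by simp
qed

section \<open>The ergodic theorem of Birkhoff\<close>

text \<open>
  The unnormalised averages; they obey a recursion in the starting point, which is what the proof of
  the maximal inequality exploits.
\<close>

definition birkhoff_sum :: "('a \<Rightarrow> 'a) \<Rightarrow> ('a \<Rightarrow> real) \<Rightarrow> nat \<Rightarrow> 'a \<Rightarrow> real" where
  "birkhoff_sum f g n w = (\<Sum>j<n. g ((f ^^ j) w))"

lemma birkhoff_sum_Suc: "birkhoff_sum f g (Suc n) w = g w + birkhoff_sum f g n (f w)"
  unfolding birkhoff_sum_def sum.lessThan_Suc_shift by (simp add: funpow_swap1)

text \<open>
  The maximum of the Birkhoff sums of lengths \<open>0, \<dots>, n\<close>, written as a recursion so that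
  integrability and monotonicity in \<open>n\<close> are plain inductions.
\<close>

fun max_birkhoff_sum :: "('a \<Rightarrow> 'a) \<Rightarrow> ('a \<Rightarrow> real) \<Rightarrow> nat \<Rightarrow> 'a \<Rightarrow> real" where
  "max_birkhoff_sum f g 0 w = 0"
| "max_birkhoff_sum f g (Suc n) w = max 0 (g w + max_birkhoff_sum f g n (f w))"

lemma max_birkhoff_sum_nonneg: "0 \<le> max_birkhoff_sum f g n w"
  by (cases n) auto

lemma max_birkhoff_sum_Suc_ge: "max_birkhoff_sum f g n w \<le> max_birkhoff_sum f g (Suc n) w"
proof (induction n arbitrary: w)
  case 0 show ?case by simp
next
  case (Suc n)
  have "g w + max_birkhoff_sum f g n (f w) \<le> g w + max_birkhoff_sum f g (Suc n) (f w)"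
    using Suc[of "f w"] by simp
  then show ?case unfolding max_birkhoff_sum.simps(2)[of f g n] max_birkhoff_sum.simps(2)[of f g "Suc n"]
    by (intro max.mono) simp_all
qed

lemma max_birkhoff_sum_mono: "m \<le> n \<Longrightarrow> max_birkhoff_sum f g m w \<le> max_birkhoff_sum f g n w"
  by (rule lift_Suc_mono_le[of "\<lambda>n. max_birkhoff_sum f g n w"]) (rule max_birkhoff_sum_Suc_ge)

lemma birkhoff_sum_le_max: "birkhoff_sum f g n w \<le> max_birkhoff_sum f g n w"
proof (induction n arbitrary: w)
  case 0 show ?case by (simp add: birkhoff_sum_def)
next
  case (Suc n)
  show ?case using Suc[of "f w"] by (simp add: birkhoff_sum_Suc)
qed

lemma integrable_max_birkhoff_sum:
  assumes f: "measure_preserving_map M f" and g: "integrable M g"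
  shows "integrable M (max_birkhoff_sum f g n)"
proof (induction n)
  case 0
  show ?case by simp
next
  case (Suc n)
  have "integrable M (\<lambda>w. max 0 (g w + max_birkhoff_sum f g n (f w)))"
    using measure_preserving_map_integral(1)[OF f Suc] g by (intro integrable_max) auto
  then show ?case by simp
qed

text \<open>
  Where the maximum \<open>F\<^sub>n\<close> is positive it is attained by a nonempty sum, so
  \<open>F\<^sub>n w = g w + F\<^sub>n\<^sub>-\<^sub>1 (f w) \<le> g w + F\<^sub>n (f w)\<close>; elsewhere \<open>F\<^sub>n w\<close> vanishes while \<open>F\<^sub>n (f w)\<close> is
  nonnegative, so the left-hand side is not positive.
\<close>

lemma max_birkhoff_sum_cocycle:
  assumes "w \<in> \<Omega>"
  shows "max_birkhoff_sum f g n w - max_birkhoff_sum f g n (f w)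
    \<le> indicator {w \<in> \<Omega>. max_birkhoff_sum f g n w > 0} w * g w"
proof (cases "max_birkhoff_sum f g n w > 0")
  case True
  then obtain k where n: "n = Suc k" by (cases n) auto
  have "max_birkhoff_sum f g n w = g w + max_birkhoff_sum f g k (f w)"
    using True unfolding n max_birkhoff_sum.simps(2) by linarith
  then show ?thesis
    using True max_birkhoff_sum_Suc_ge[of f g k "f w"] assms unfolding n by simp
next
  case False
  then show ?thesis using max_birkhoff_sum_nonneg[of f g n w] max_birkhoff_sum_nonneg[of f g n "f w"]
    by simp
qed

text \<open>
  Garsia's proof: integrate the pointwise inequality above; the left-hand side has integral zero by
  invariance.
\<close>

theorem maximal_ergodic:
  assumes f: "measure_preserving_map M f" and g: "integrable M g"
  shows "0 \<le> (\<integral>w. indicator {w \<in> space M. max_birkhoff_sum f g n w > 0} w * g w \<partial>M)"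
proof -
  let ?F = "max_birkhoff_sum f g n"
  have F: "integrable M ?F" by (rule integrable_max_birkhoff_sum[OF f g])
  note Ff = measure_preserving_map_integral[OF f F]
  have [measurable]: "?F \<in> borel_measurable M" using F by simp
  have "{w \<in> space M. ?F w > 0} \<in> sets M" by measurable
  then have int: "integrable M (\<lambda>w. indicator {w \<in> space M. ?F w > 0} w * g w)"
    using integrable_mult_indicator[OF _ g] by simp
  have "0 = (\<integral>w. ?F w - ?F (f w) \<partial>M)" using Ff F by simp
  also have "\<dots> \<le> (\<integral>w. indicator {w \<in> space M. ?F w > 0} w * g w \<partial>M)"
    by (rule integral_mono[OF Bochner_Integration.integrable_diff[OF F Ff(1)] int])
      (rule max_birkhoff_sum_cocycle)
  finally show ?thesis .
qed

lemma birkhoff_sum_measurable: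
  assumes "measure_preserving_map M f" "g \<in> borel_measurable M"
  shows "birkhoff_sum f g n \<in> borel_measurable M"
proof -
  have "(\<lambda>w. g ((f ^^ j) w)) \<in> borel_measurable M" for j
  proof (rule measurable_compose[OF _ assms(2)])
    show "f ^^ j \<in> M \<rightarrow>\<^sub>M M"
      using measure_preserving_map_funpow[OF assms(1)] by (simp add: measure_preserving_map_def)
  qed
  then show ?thesis unfolding birkhoff_sum_def[abs_def] by (rule borel_measurable_sum)
qed

text \<open>
  The set of points with unbounded Birkhoff sums is strictly invariant, because passing from \<open>w\<close> to
  \<open>f w\<close> changes the sums by the constant \<open>g w\<close>.  If it had measure one, the sets in the maximal
  inequality would exhaust the space and the integral of \<open>g\<close> would be nonnegative.
\<close>

lemma (in prob_space) birkhoff_sum_bounded_above: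
  assumes erg: "ergodic M f" and g: "integrable M g" and neg: "integral\<^sup>L M g < 0"
  shows "AE w in M. \<exists>K. \<forall>n. birkhoff_sum f g n w \<le> K"
proof -
  have f: "measure_preserving_map M f" using erg by (simp add: ergodic_def)
  then have fM: "f \<in> M \<rightarrow>\<^sub>M M" by (simp add: measure_preserving_map_def)
  have [measurable]: "birkhoff_sum f g n \<in> borel_measurable M" for n
    by (rule birkhoff_sum_measurable[OF f]) (use g in simp)
  \<comment> \<open>Natural bounds \<open>K\<close> make \<open>E\<close> visibly measurable; \<open>E_iff\<close> restores real ones.\<close>
  define E where "E = {w \<in> space M. \<forall>K::nat. \<exists>n. birkhoff_sum f g n w > real K}"
  have E [measurable]: "E \<in> sets M" unfolding E_def by measurable
  have E_iff: "w \<in> E \<longleftrightarrow> w \<in> space M \<and> (\<forall>K. \<exists>n. birkhoff_sum f g n w > K)" for w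
  proof (intro iffI conjI allI)
    fix K assume w: "w \<in> E"
    obtain k :: nat where k: "K \<le> real k" using real_arch_simple by blast
    from w have "\<exists>n. birkhoff_sum f g n w > real k" by (simp only: E_def mem_Collect_eq)
    then obtain n where "birkhoff_sum f g n w > real k" ..
    with k have "birkhoff_sum f g n w > K" by linarith
    then show "\<exists>n. birkhoff_sum f g n w > K" ..
  next
    assume "w \<in> E" then show "w \<in> space M" by (simp only: E_def mem_Collect_eq)
  next
    assume "w \<in> space M \<and> (\<forall>K. \<exists>n. birkhoff_sum f g n w > K)"
    then show "w \<in> E" by (simp only: E_def mem_Collect_eq simp_thms)
  qed
  have "f -` E \<inter> space M = E"
  proof (intro set_eqI iffI)
    fix w assume "w \<in> f -` E \<inter> space M"
    then have w: "f w \<in> E" "w \<in> space M" by auto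
    have "\<exists>n. birkhoff_sum f g n w > K" for K
    proof -
      have "\<exists>n. birkhoff_sum f g n (f w) > K - g w" using w(1) by (simp only: E_iff)
      then obtain n where "birkhoff_sum f g n (f w) > K - g w" ..
      then have "birkhoff_sum f g (Suc n) w > K" by (simp add: birkhoff_sum_Suc)
      then show ?thesis ..
    qed
    then show "w \<in> E" using w(2) unfolding E_iff by blast
  next
    fix w assume w: "w \<in> E"
    then have sp: "w \<in> space M" by (simp add: E_def)
    have "\<exists>n. birkhoff_sum f g n (f w) > K" for K
    proof -
      have "\<exists>n. birkhoff_sum f g n w > max 0 (K + g w)" using w by (simp only: E_iff)
      then obtain n where n: "birkhoff_sum f g n w > max 0 (K + g w)" ..
      then obtain k where "n = Suc k" by (cases n) (auto simp: birkhoff_sum_def)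
      then have "birkhoff_sum f g k (f w) > K" using n by (simp add: birkhoff_sum_Suc)
      then show ?thesis ..
    qed
    then show "w \<in> f -` E \<inter> space M"
      using sp measurable_space[OF fM sp] by (simp add: E_iff)
  qed
  then have "prob E = 0 \<or> prob E = 1" using erg E by (simp add: ergodic_def)
  moreover have "prob E \<noteq> 1"
  proof
    assume "prob E = 1"
    then have AE: "AE w in M. w \<in> E" using prob_eq_1[OF E] by simp
    let ?P = "\<lambda>n. {w \<in> space M. max_birkhoff_sum f g n w > 0}"
    have mF [measurable]: "max_birkhoff_sum f g n \<in> borel_measurable M" for n
      by (rule borel_measurable_integrable[OF integrable_max_birkhoff_sum[OF f g]])
    have lim: "(\<lambda>n. indicator (?P n) w * g w) \<longlonglongrightarrow> g w" if "w \<in> E" for w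
    proof -
      have "\<exists>n. birkhoff_sum f g n w > 0" using that by (simp add: E_iff)
      then obtain n where n: "birkhoff_sum f g n w > 0" ..
      have "indicator (?P k) w * g w = g w" if "k \<ge> n" for k
        using n birkhoff_sum_le_max[of f g n w] max_birkhoff_sum_mono[OF that, of f g w] \<open>w \<in> E\<close>
        by (simp add: E_iff)
      then show ?thesis
        by (intro tendsto_eventually eventually_sequentiallyI[of n])
    qed
    have "(\<lambda>n. \<integral>w. indicator (?P n) w * g w \<partial>M) \<longlonglongrightarrow> integral\<^sup>L M g"
    proof (rule integral_dominated_convergence)
      show "integrable M (\<lambda>w. \<bar>g w\<bar>)" using g by simp
      show "AE w in M. (\<lambda>n. indicator (?P n) w * g w) \<longlonglongrightarrow> g w"
        using AE by eventually_elim (rule lim)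
      show "AE w in M. norm (indicator (?P n) w * g w) \<le> \<bar>g w\<bar>" for n
        by (auto simp: indicator_def)
      show "g \<in> borel_measurable M" using g by (rule borel_measurable_integrable)
      then show "(\<lambda>w. indicator (?P n) w * g w) \<in> borel_measurable M" for n
        by (intro borel_measurable_times borel_measurable_indicator) measurable
    qed
    then have "0 \<le> integral\<^sup>L M g"
      by (rule LIMSEQ_le_const) (intro exI allI impI maximal_ergodic[OF f g])
    with neg show False by simp
  qed
  ultimately have "prob E = 0" by simp
  then have "AE w in M. w \<notin> E" using prob_eq_0[OF E] by simp
  then show ?thesis
    using AE_space by eventually_elim (auto simp: E_iff not_less)
qed

text \<open>
  Subtracting from \<open>g\<close> a constant \<open>b\<close> above its mean gives a function of negative mean; a bound \<open>K\<close>
  for its Birkhoff sums says that the averages of \<open>g\<close> are at most \<open>b + K / N\<close>.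
\<close>

lemma (in prob_space) birkhoff_avg_eventually_less:
  assumes erg: "ergodic M f" and g: "integrable M g" and less: "integral\<^sup>L M g < a"
  shows "AE w in M. eventually (\<lambda>N. birkhoff_avg f g N w < a) sequentially"
proof -
  obtain b where b: "integral\<^sup>L M g < b" "b < a" using dense[OF less] by blast
  have "AE w in M. \<exists>K. \<forall>n. birkhoff_sum f (\<lambda>w. g w - b) n w \<le> K"
    by (rule birkhoff_sum_bounded_above[OF erg]) (use g b prob_space in auto)
  then show ?thesis
  proof eventually_elim
    fix w assume "\<exists>K. \<forall>n. birkhoff_sum f (\<lambda>w. g w - b) n w \<le> K"
    then obtain K where K: "\<And>n. birkhoff_sum f (\<lambda>w. g w - b) n w \<le> K" by blast
    have "(\<lambda>N. b + K / real N) \<longlonglongrightarrow> b + 0"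
      by (intro tendsto_intros lim_const_over_n)
    then have "eventually (\<lambda>N. b + K / real N < a) sequentially"
      using b by (intro order_tendstoD(2)) auto
    then show "eventually (\<lambda>N. birkhoff_avg f g N w < a) sequentially"
      using eventually_gt_at_top[of 0]
    proof eventually_elim
      fix N :: nat assume N: "b + K / real N < a" "0 < N"
      have "(\<Sum>j<N. g ((f ^^ j) w)) \<le> K + real N * b"
        using K[of N] by (simp add: birkhoff_sum_def sum_subtractf)
      then have "birkhoff_avg f g N w \<le> (K + real N * b) / real N"
        by (simp add: birkhoff_avg_def divide_right_mono)
      also have "\<dots> = b + K / real N" using N by (simp add: field_simps)
      finally show "birkhoff_avg f g N w < a" using N by simp
    qed
  qed
qed

text \<open>
  The one-sided estimate for \<open>g\<close> and for \<open>- g\<close> along a sequence of thresholds.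
\<close>

theorem (in prob_space) birkhoff_ergodic:
  assumes erg: "ergodic M f" and g: "integrable M g"
  shows "AE w in M. (\<lambda>N. birkhoff_avg f g N w) \<longlonglongrightarrow> integral\<^sup>L M g"
proof -
  let ?I = "integral\<^sup>L M g"
  have "AE w in M. \<forall>k::nat. eventually (\<lambda>N. birkhoff_avg f g N w < ?I + 1 / Suc k) sequentially"
    unfolding AE_all_countable by (intro allI birkhoff_avg_eventually_less[OF erg g]) simp
  moreover have "AE w in M. \<forall>k::nat. eventually
      (\<lambda>N. birkhoff_avg f (\<lambda>w. - g w) N w < - ?I + 1 / Suc k) sequentially"
    unfolding AE_all_countable by (intro allI birkhoff_avg_eventually_less[OF erg]) (use g in simp_all)
  ultimately show ?thesis
  proof eventually_elim
    fix w
    assume up: "\<forall>k::nat. eventually (\<lambda>N. birkhoff_avg f g N w < ?I + 1 / Suc k) sequentially"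
      and dn: "\<forall>k::nat. eventually (\<lambda>N. birkhoff_avg f (\<lambda>w. - g w) N w < - ?I + 1 / Suc k) sequentially"
    have neg: "birkhoff_avg f (\<lambda>w. - g w) N w = - birkhoff_avg f g N w" for N
      by (simp add: birkhoff_avg_def sum_negf)
    show "(\<lambda>N. birkhoff_avg f g N w) \<longlonglongrightarrow> ?I"
    proof (rule tendstoI)
      fix e :: real assume "e > 0"
      then obtain k :: nat where k: "1 / Suc k < e" using nat_approx_posE by blast
      show "eventually (\<lambda>N. dist (birkhoff_avg f g N w) ?I < e) sequentially"
        using up[rule_format, of k] dn[rule_format, of k]
        by eventually_elim (use k in \<open>unfold neg dist_real_def abs_less_iff, linarith\<close>)
    qed
  qed
qed

section \<open>Mixing\<close>

definition mixing :: "'a measure \<Rightarrow> ('a \<Rightarrow> 'a) \<Rightarrow> bool" where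
  "mixing M f \<longleftrightarrow> measure_preserving_map M f \<and>
    (\<forall>A\<in>sets M. \<forall>B\<in>sets M.
      (\<lambda>n. measure M ((f ^^ n) -` A \<inter> B)) \<longlonglongrightarrow> measure M A * measure M B)"

lemma mixingD:
  assumes "mixing M f"
  shows "measure_preserving_map M f"
    and "A \<in> sets M \<Longrightarrow> B \<in> sets M \<Longrightarrow>
      (\<lambda>n. measure M ((f ^^ n) -` A \<inter> B)) \<longlonglongrightarrow> measure M A * measure M B"
  using assms by (auto simp: mixing_def)

text \<open>
  For an invariant set, mixing of the set with itself gives \<open>p = p * p\<close>.
\<close>

lemma ergodic_if_mixing:
  assumes "mixing M f"
  shows "ergodic M f"
proof -
  have f: "measure_preserving_map M f" using assms by (simp add: mixing_def)
  have "measure M E = 0 \<or> measure M E = 1" if E: "E \<in> sets M" "f -` E \<inter> space M = E" for E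
  proof -
    have "(f ^^ n) -` E \<inter> E = E" for n
    proof (induction n)
      case (Suc n)
      have "f w \<in> E" if "w \<in> E" for w using E(2) that by blast
      then have "(f ^^ n) w \<in> E" if "w \<in> E" for n w using that by (induction n) auto
      then show ?case by blast
    qed simp
    moreover have "(\<lambda>n. measure M ((f ^^ n) -` E \<inter> E)) \<longlonglongrightarrow> measure M E * measure M E"
      using assms E(1) by (simp add: mixing_def)
    ultimately have "(\<lambda>n::nat. measure M E) \<longlonglongrightarrow> measure M E * measure M E" by simp
    then have "measure M E = measure M E * measure M E"
      by (rule LIMSEQ_unique[OF tendsto_const])
    then show ?thesis by simp
  qed
  with f show ?thesis by (simp add: ergodic_def)
qed

text \<open>
  The Dynkin step behind the reduction to a generator.  Countable disjoint unions need an exchange of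
  limit and sum, which Tannery's theorem permits because \<open>\<nu> n (D i)\<close> is dominated by the summable
  sequence \<open>prob (D i)\<close>.  The functional \<open>\<nu>\<close> is kept abstract since the lemma is applied to both
  arguments of \<open>prob ((f ^^ n) -` A \<inter> B)\<close> in turn.
\<close>

lemma (in prob_space) tendsto_measure_from_generator:
  fixes \<nu> :: "nat \<Rightarrow> 'a set \<Rightarrow> real"
  assumes E: "Int_stable E" "E \<subseteq> Pow (space M)" "sets M = sigma_sets (space M) E"
    and basic: "\<And>A. A \<in> E \<Longrightarrow> (\<lambda>n. \<nu> n A) \<longlonglongrightarrow> c * prob A"
    and whole: "(\<lambda>n. \<nu> n (space M)) \<longlonglongrightarrow> c"
    and bounds: "\<And>n A. A \<in> events \<Longrightarrow> 0 \<le> \<nu> n A \<and> \<nu> n A \<le> prob A"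
    and compl: "\<And>n A. A \<in> events \<Longrightarrow> \<nu> n (space M - A) = \<nu> n (space M) - \<nu> n A"
    and union: "\<And>n D. range D \<subseteq> events \<Longrightarrow> disjoint_family D \<Longrightarrow> (\<lambda>i. \<nu> n (D i)) sums \<nu> n (\<Union>i. D i)"
    and A: "A \<in> events"
  shows "(\<lambda>n. \<nu> n A) \<longlonglongrightarrow> c * prob A"
proof -
  have "A \<in> sigma_sets (space M) E" using A E(3) by simp
  with E(1,2) show ?thesis
  proof (induction rule: sigma_sets_induct_disjoint)
    case (basic A)
    then show ?case by (rule assms(4))
  next
    case empty
    have "\<nu> n {} = 0" for n using bounds[of "{}" n] by simp
    then show ?case by simp
  next
    case (compl A)
    then have A: "A \<in> events" using E(3) by simp
    have "(\<lambda>n. \<nu> n (space M) - \<nu> n A) \<longlonglongrightarrow> c - c * prob A"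
      by (intro tendsto_diff whole compl)
    then show ?case
      by (simp add: assms(7)[OF A] prob_compl[OF A] right_diff_distrib)
  next
    case (union D)
    have D: "range D \<subseteq> events" "disjoint_family D" using union(1,2) E(3) by auto
    have sums: "(\<lambda>i. prob (D i)) sums prob (\<Union>i. D i)"
      by (rule finite_measure_UNION[OF D])
    have "(\<lambda>n. \<Sum>i. \<nu> n (D i)) \<longlonglongrightarrow> (\<Sum>i. c * prob (D i))"
    proof (rule tannerys_theorem[THEN conjunct2, THEN conjunct2])
      show "(\<lambda>n. \<nu> n (D i)) \<longlonglongrightarrow> c * prob (D i)" for i by (rule union(3))
      have "norm (\<nu> n (D i)) \<le> prob (D i)" for n i
        using bounds[of "D i" n] D(1) by auto
      then show "\<forall>\<^sub>F (i, n) in sequentially \<times>\<^sub>F sequentially. norm (\<nu> n (D i)) \<le> prob (D i)"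
        by (intro always_eventually) auto
      show "summable (\<lambda>i. prob (D i))" using sums by (rule sums_summable)
    qed simp
    moreover have "(\<Sum>i. \<nu> n (D i)) = \<nu> n (\<Union>i. D i)" for n
      by (rule sums_unique[symmetric, OF assms(8)[OF D]])
    moreover have "(\<Sum>i. c * prob (D i)) = c * prob (\<Union>i. D i)"
      by (rule sums_unique[symmetric, OF sums_mult[OF sums]])
    ultimately show ?case by simp
  qed
qed

text \<open>
  The Dynkin step is taken twice: first the preimage \<open>A\<close> becomes an arbitrary event while \<open>B\<close> stays
  in the generator, then \<open>B\<close> becomes arbitrary as well.
\<close>

lemma (in prob_space) mixing_from_generator:
  assumes f: "measure_preserving_map M f"
    and E: "Int_stable E" "E \<subseteq> Pow (space M)" "sets M = sigma_sets (space M) E"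
    and lim: "\<And>A B. A \<in> E \<Longrightarrow> B \<in> E \<Longrightarrow>
      (\<lambda>n. prob ((f ^^ n) -` A \<inter> B)) \<longlonglongrightarrow> prob A * prob B"
  shows "mixing M f"
proof -
  have fn: "f ^^ n \<in> M \<rightarrow>\<^sub>M M" for n
    using f by (intro measurable_funpow) (simp add: measure_preserving_map_def)
  have EM: "B \<in> events" if "B \<in> E" for B using that E(3) by simp
  have eq: "(f ^^ n) -` A \<inter> B = ((f ^^ n) -` A \<inter> space M) \<inter> B" if "B \<in> events" for n A B
    using sets.sets_into_space[OF that] by blast
  have ev: "(f ^^ n) -` A \<inter> B \<in> events" if "A \<in> events" "B \<in> events" for n A B
    using f that by (intro vimage_funpow_Int_sets) (simp_all add: measure_preserving_map_def)
  have pre: "prob ((f ^^ n) -` A \<inter> space M) = prob A" if "A \<in> events" for n A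
    by (rule measure_preserving_mapD[OF measure_preserving_map_funpow[OF f] that])
  have step1: "(\<lambda>n. prob ((f ^^ n) -` A \<inter> B)) \<longlonglongrightarrow> prob A * prob B"
    if A: "A \<in> events" and B: "B \<in> E" for A B
  proof -
    have Bv: "B \<in> events" by (rule EM[OF B])
    have sp: "(f ^^ n) -` space M \<inter> B = B" for n
      using sets.sets_into_space[OF Bv] measurable_space[OF fn] by blast
    have "(\<lambda>n. prob ((f ^^ n) -` A \<inter> B)) \<longlonglongrightarrow> prob B * prob A"
    proof (rule tendsto_measure_from_generator[OF E _ _ _ _ _ A])
      show "(\<lambda>n. prob ((f ^^ n) -` A \<inter> B)) \<longlonglongrightarrow> prob B * prob A" if "A \<in> E" for A
        using lim[OF that B] by (simp add: mult.commute)
      show "(\<lambda>n. prob ((f ^^ n) -` space M \<inter> B)) \<longlonglongrightarrow> prob B" by (simp add: sp)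
    next
      fix n A assume A: "A \<in> events"
      have "prob ((f ^^ n) -` A \<inter> B) \<le> prob ((f ^^ n) -` A \<inter> space M)"
        unfolding eq[OF Bv] using measurable_sets[OF fn A] by (intro finite_measure_mono) auto
      then show "0 \<le> prob ((f ^^ n) -` A \<inter> B) \<and> prob ((f ^^ n) -` A \<inter> B) \<le> prob A"
        by (simp add: pre[OF A])
      have "(f ^^ n) -` (space M - A) \<inter> B = B - ((f ^^ n) -` A \<inter> B)"
        using sp[of n] by blast
      then show "prob ((f ^^ n) -` (space M - A) \<inter> B)
          = prob ((f ^^ n) -` space M \<inter> B) - prob ((f ^^ n) -` A \<inter> B)"
        using finite_measure_Diff[OF Bv ev[OF A Bv]] by (simp add: sp)
    next
      fix n and D :: "nat \<Rightarrow> 'a set" assume D: "range D \<subseteq> events" "disjoint_family D"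
      have "(\<lambda>i. prob ((f ^^ n) -` D i \<inter> B)) sums prob (\<Union>i. (f ^^ n) -` D i \<inter> B)"
      proof (rule finite_measure_UNION)
        show "range (\<lambda>i. (f ^^ n) -` D i \<inter> B) \<subseteq> events" using D(1) ev[OF _ Bv] by blast
        show "disjoint_family (\<lambda>i. (f ^^ n) -` D i \<inter> B)"
          using D(2) unfolding disjoint_family_on_def by blast
      qed
      moreover have "(\<Union>i. (f ^^ n) -` D i \<inter> B) = (f ^^ n) -` (\<Union>i. D i) \<inter> B" by blast
      ultimately show "(\<lambda>i. prob ((f ^^ n) -` D i \<inter> B)) sums prob ((f ^^ n) -` (\<Union>i. D i) \<inter> B)"
        by simp
    qed
    then show ?thesis by (simp add: mult.commute)
  qed
  have step2: "(\<lambda>n. prob ((f ^^ n) -` A \<inter> B)) \<longlonglongrightarrow> prob A * prob B"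
    if A: "A \<in> events" and B: "B \<in> events" for A B
  proof (rule tendsto_measure_from_generator[OF E _ _ _ _ _ B])
    show "(\<lambda>n. prob ((f ^^ n) -` A \<inter> B)) \<longlonglongrightarrow> prob A * prob B" if "B \<in> E" for B
      by (rule step1[OF A that])
    show "(\<lambda>n. prob ((f ^^ n) -` A \<inter> space M)) \<longlonglongrightarrow> prob A" by (simp add: pre[OF A])
  next
    fix n B assume B: "B \<in> events"
    show "0 \<le> prob ((f ^^ n) -` A \<inter> B) \<and> prob ((f ^^ n) -` A \<inter> B) \<le> prob B"
      using finite_measure_mono[OF _ B, of "(f ^^ n) -` A \<inter> B"] by simp
    have "(f ^^ n) -` A \<inter> (space M - B) = ((f ^^ n) -` A \<inter> space M) - ((f ^^ n) -` A \<inter> B)"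
      by blast
    moreover have "(f ^^ n) -` A \<inter> B \<subseteq> (f ^^ n) -` A \<inter> space M"
      using sets.sets_into_space[OF B] by blast
    ultimately show "prob ((f ^^ n) -` A \<inter> (space M - B))
        = prob ((f ^^ n) -` A \<inter> space M) - prob ((f ^^ n) -` A \<inter> B)"
      using finite_measure_Diff[OF ev[OF A sets.top] ev[OF A B]] by simp
  next
    fix n and D :: "nat \<Rightarrow> 'a set" assume D: "range D \<subseteq> events" "disjoint_family D"
    have "(\<lambda>i. prob ((f ^^ n) -` A \<inter> D i)) sums prob (\<Union>i. (f ^^ n) -` A \<inter> D i)"
    proof (rule finite_measure_UNION)
      show "range (\<lambda>i. (f ^^ n) -` A \<inter> D i) \<subseteq> events" using D(1) ev[OF A] by blast
      show "disjoint_family (\<lambda>i. (f ^^ n) -` A \<inter> D i)"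
        using D(2) unfolding disjoint_family_on_def by blast
    qed
    moreover have "(\<Union>i. (f ^^ n) -` A \<inter> D i) = (f ^^ n) -` A \<inter> (\<Union>i. D i)" by blast
    ultimately show "(\<lambda>i. prob ((f ^^ n) -` A \<inter> D i)) sums prob ((f ^^ n) -` A \<inter> (\<Union>i. D i))"
      by simp
  qed
  show ?thesis unfolding mixing_def using f step2 by blast
qed

lemma funpow_intertwine:
  assumes "f \<in> M \<rightarrow>\<^sub>M M" "\<And>w. w \<in> space M \<Longrightarrow> \<pi> (f w) = g (\<pi> w)" "w \<in> space M"
  shows "(f ^^ n) w \<in> space M" "\<pi> ((f ^^ n) w) = (g ^^ n) (\<pi> w)"
proof -
  show sp: "(f ^^ n) w \<in> space M" for n
    by (rule measurable_space[OF measurable_funpow[OF assms(1)] assms(3)])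
  show "\<pi> ((f ^^ n) w) = (g ^^ n) (\<pi> w)"
    by (induction n) (simp_all add: assms(2)[OF sp])
qed

lemma vimage_funpow_intertwine:
  assumes "f \<in> M \<rightarrow>\<^sub>M M" "\<And>w. w \<in> space M \<Longrightarrow> \<pi> (f w) = g (\<pi> w)"
  shows "\<pi> -` ((g ^^ n) -` A \<inter> B) \<inter> space M
    = (f ^^ n) -` (\<pi> -` A \<inter> space M) \<inter> (\<pi> -` B \<inter> space M)"
  using funpow_intertwine[of f M \<pi> g, OF assms] by auto

lemma mixing_factor:
  assumes mix: "mixing M f"
    and \<pi>: "\<pi> \<in> M \<rightarrow>\<^sub>M N" and g: "g \<in> N \<rightarrow>\<^sub>M N"
    and comm: "\<And>w. w \<in> space M \<Longrightarrow> \<pi> (f w) = g (\<pi> w)"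
  shows "mixing (distr M N \<pi>) g"
proof -
  have f: "f \<in> M \<rightarrow>\<^sub>M M" "distr M M f = M"
    using mix by (auto simp: mixing_def measure_preserving_map_def)
  have "distr (distr M N \<pi>) N g = distr M N (g \<circ> \<pi>)" by (rule distr_distr[OF g \<pi>])
  also have "\<dots> = distr M N (\<pi> \<circ> f)" by (intro distr_cong) (simp_all add: comm)
  also have "\<dots> = distr (distr M M f) N \<pi>" by (rule distr_distr[symmetric, OF \<pi> f(1)])
  finally have "distr (distr M N \<pi>) N g = distr M N \<pi>" unfolding f(2) .
  moreover have "distr (distr M N \<pi>) (distr M N \<pi>) g = distr (distr M N \<pi>) N g"
    by (intro distr_cong) simp_all
  ultimately have mp: "measure_preserving_map (distr M N \<pi>) g"
    using g by (simp add: measure_preserving_map_def)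
  have "(\<lambda>n. measure (distr M N \<pi>) ((g ^^ n) -` A \<inter> B))
      \<longlonglongrightarrow> measure (distr M N \<pi>) A * measure (distr M N \<pi>) B"
    if A: "A \<in> sets N" and B: "B \<in> sets N" for A B
  proof -
    have "measure (distr M N \<pi>) ((g ^^ n) -` A \<inter> B)
        = measure M ((f ^^ n) -` (\<pi> -` A \<inter> space M) \<inter> (\<pi> -` B \<inter> space M))" for n
      unfolding measure_distr[OF \<pi> vimage_funpow_Int_sets[OF g A B]]
      by (simp only: vimage_funpow_intertwine[of f M \<pi> g, OF f(1) comm])
    moreover have "\<dots> \<longlonglongrightarrow> measure M (\<pi> -` A \<inter> space M) * measure M (\<pi> -` B \<inter> space M)"
      by (rule mixingD(2)[OF mix measurable_sets[OF \<pi> A] measurable_sets[OF \<pi> B]])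
    ultimately show ?thesis by (simp add: measure_distr[OF \<pi>] A B)
  qed
  then show ?thesis using mp by (simp add: mixing_def)
qed

text \<open>
  A factor map that loses no event identifies the two systems as far as measures of events are
  concerned, even if it is not invertible; correlations upstairs are then correlations downstairs.
\<close>

lemma mixing_extension:
  assumes mix: "mixing (distr M N \<pi>) g"
    and \<pi>: "\<pi> \<in> M \<rightarrow>\<^sub>M N" and f: "f \<in> M \<rightarrow>\<^sub>M M"
    and comm: "\<And>w. w \<in> space M \<Longrightarrow> \<pi> (f w) = g (\<pi> w)"
    and sets: "\<And>A. A \<in> sets M \<Longrightarrow> \<exists>A'\<in>sets N. A = \<pi> -` A' \<inter> space M"
  shows "mixing M f"
proof -
  let ?N = "distr M N \<pi>"
  have gm: "measure_preserving_map ?N g" using mix by (simp add: mixing_def)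
  then have g: "g \<in> N \<rightarrow>\<^sub>M N" by (simp add: measure_preserving_map_def)
  have "distr M M f = M"
  proof (rule measure_eqI)
    fix A assume "A \<in> sets (distr M M f)"
    then have "A \<in> sets M" by simp
    then obtain A' where A': "A' \<in> sets N" "A = \<pi> -` A' \<inter> space M" using sets by blast
    have gA: "g -` A' \<inter> space N \<in> sets N" by (rule measurable_sets[OF g A'(1)])
    have "emeasure (distr M M f) A = emeasure M (f -` A \<inter> space M)"
      by (rule emeasure_distr[OF f \<open>A \<in> sets M\<close>])
    also have "f -` A \<inter> space M = \<pi> -` (g -` A' \<inter> space N) \<inter> space M"
      unfolding A'(2) using measurable_space[OF f] measurable_space[OF \<pi>] comm by auto
    also have "emeasure M \<dots> = emeasure ?N (g -` A' \<inter> space ?N)"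
      by (simp add: emeasure_distr[OF \<pi> gA])
    also have "\<dots> = emeasure (distr ?N ?N g) A'"
      using g A'(1) by (simp add: emeasure_distr)
    also have "\<dots> = emeasure ?N A'" using gm by (simp add: measure_preserving_map_def)
    also have "\<dots> = emeasure M A" by (simp add: emeasure_distr[OF \<pi> A'(1)] A'(2))
    finally show "emeasure (distr M M f) A = emeasure M A" .
  qed simp
  then have mp: "measure_preserving_map M f" using f by (simp add: measure_preserving_map_def)
  have "(\<lambda>n. measure M ((f ^^ n) -` A \<inter> B)) \<longlonglongrightarrow> measure M A * measure M B"
    if A: "A \<in> sets M" and B: "B \<in> sets M" for A B
  proof -
    obtain A' where A': "A' \<in> sets N" "A = \<pi> -` A' \<inter> space M" using sets[OF A] by blast
    obtain B' where B': "B' \<in> sets N" "B = \<pi> -` B' \<inter> space M" using sets[OF B] by blast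
    have "measure M ((f ^^ n) -` A \<inter> B) = measure ?N ((g ^^ n) -` A' \<inter> B')" for n
      unfolding A'(2) B'(2) measure_distr[OF \<pi> vimage_funpow_Int_sets[OF g A'(1) B'(1)]]
      by (simp only: vimage_funpow_intertwine[of f M \<pi> g, OF f comm])
    moreover have "(\<lambda>n. measure ?N ((g ^^ n) -` A' \<inter> B')) \<longlonglongrightarrow> measure ?N A' * measure ?N B'"
      using mix A'(1) B'(1) by (simp add: mixing_def)
    ultimately show ?thesis by (simp add: measure_distr[OF \<pi>] A' B')
  qed
  then show ?thesis using mp by (simp add: mixing_def)
qed

lemma measure_pair_Times:
  assumes "sigma_finite_measure N" "A \<in> sets M" "B \<in> sets N"
  shows "measure (M \<Otimes>\<^sub>M N) (A \<times> B) = measure M A * measure N B"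
  using sigma_finite_measure.emeasure_pair_measure_Times[OF assms]
  by (simp add: measure_def enn2real_mult)

text \<open>
  On rectangles the correlations of the product factorise into those of the two factors.
\<close>

lemma mixing_product:
  assumes M: "prob_space M" "mixing M f" and N: "prob_space N" "mixing N g"
  shows "mixing (M \<Otimes>\<^sub>M N) (map_prod f g)"
proof -
  interpret M: prob_space M by fact
  interpret N: prob_space N by fact
  interpret pair_prob_space M N ..
  have f: "f \<in> M \<rightarrow>\<^sub>M M" "distr M M f = M" and g: "g \<in> N \<rightarrow>\<^sub>M N" "distr N N g = N"
    using M N by (auto simp: mixing_def measure_preserving_map_def)
  have "distr M M f \<Otimes>\<^sub>M distr N N g = distr (M \<Otimes>\<^sub>M N) (M \<Otimes>\<^sub>M N) (\<lambda>(x, y). (f x, g y))"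
    by (rule pair_measure_distr[OF f(1) g(1)]) (unfold g(2), unfold_locales)
  moreover have "(\<lambda>(x, y). (f x, g y)) = map_prod f g" by (simp add: fun_eq_iff)
  moreover have "map_prod f g \<in> M \<Otimes>\<^sub>M N \<rightarrow>\<^sub>M M \<Otimes>\<^sub>M N"
    using f g by (simp add: map_prod_def split_beta')
  ultimately have mp: "measure_preserving_map (M \<Otimes>\<^sub>M N) (map_prod f g)"
    by (simp add: measure_preserving_map_def f(2) g(2))
  have pow: "map_prod f g ^^ n = map_prod (f ^^ n) (g ^^ n)" for n
    by (induction n) (simp_all add: map_prod_compose id_def prod.map_ident fun_eq_iff)
  show ?thesis
  proof (rule mixing_from_generator[OF mp Int_stable_pair_measure_generator[of M N]])
    show "{a \<times> b |a b. a \<in> sets M \<and> b \<in> sets N} \<subseteq> Pow (space (M \<Otimes>\<^sub>M N))"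
      unfolding space_pair_measure by (rule pair_measure_closed)
    show "sets (M \<Otimes>\<^sub>M N) = sigma_sets (space (M \<Otimes>\<^sub>M N)) {a \<times> b |a b. a \<in> sets M \<and> b \<in> sets N}"
      unfolding space_pair_measure by (rule sets_pair_measure)
  next
    fix P Q assume "P \<in> {a \<times> b |a b. a \<in> sets M \<and> b \<in> sets N}" "Q \<in> {a \<times> b |a b. a \<in> sets M \<and> b \<in> sets N}"
    then obtain A B A' B' where P: "P = A \<times> B" "A \<in> sets M" "B \<in> sets N"
      and Q: "Q = A' \<times> B'" "A' \<in> sets M" "B' \<in> sets N" by auto
    have "(map_prod f g ^^ n) -` P \<inter> Q = ((f ^^ n) -` A \<inter> A') \<times> ((g ^^ n) -` B \<inter> B')" for n
      unfolding pow P Q by auto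
    then have "prob ((map_prod f g ^^ n) -` P \<inter> Q)
        = M.prob ((f ^^ n) -` A \<inter> A') * N.prob ((g ^^ n) -` B \<inter> B')" for n
      using vimage_funpow_Int_sets[OF f(1) P(2) Q(2)] vimage_funpow_Int_sets[OF g(1) P(3) Q(3)]
      by (simp add: measure_pair_Times[OF N.sigma_finite_measure_axioms])
    moreover have "(\<lambda>n. M.prob ((f ^^ n) -` A \<inter> A') * N.prob ((g ^^ n) -` B \<inter> B'))
        \<longlonglongrightarrow> (M.prob A * M.prob A') * (N.prob B * N.prob B')"
      using M(2) N(2) P Q by (intro tendsto_mult) (auto simp: mixing_def)
    ultimately show "(\<lambda>n. prob ((map_prod f g ^^ n) -` P \<inter> Q)) \<longlonglongrightarrow> prob P * prob Q"
      using P Q by (simp add: measure_pair_Times[OF N.sigma_finite_measure_axioms] mult_ac)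
  qed
qed

section \<open>The two-sided Bernoulli shift\<close>

text \<open>
  A two-sided sequence is stored as a pair of its past, read backwards, and its future; the shift
  moves the first letter of the future to the front of the past.
\<close>

definition two_sided_shift :: "(nat \<Rightarrow> 'a) \<times> (nat \<Rightarrow> 'a) \<Rightarrow> (nat \<Rightarrow> 'a) \<times> (nat \<Rightarrow> 'a)" where
  "two_sided_shift = (\<lambda>(p, f). (case_nat (f 0) p, \<lambda>k. f (Suc k)))"

lemma Pi_nat_iff:
  "w \<in> Pi UNIV A \<longleftrightarrow> w 0 \<in> A 0 \<and> (\<lambda>k. w (Suc k)) \<in> Pi UNIV (\<lambda>k. A (Suc k))"
proof -
  have "w k \<in> A k" if "w 0 \<in> A 0" "\<And>k. w (Suc k) \<in> A (Suc k)" for k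
    using that by (cases k) auto
  then show ?thesis by (auto simp: Pi_iff)
qed

lemma two_sided_shift_vimage_box:
  "two_sided_shift -` (Pi UNIV A \<times> Pi UNIV B) = Pi UNIV (\<lambda>k. A (Suc k)) \<times> Pi UNIV (case_nat (A 0) B)"
proof (intro set_eqI)
  fix w :: "(nat \<Rightarrow> 'a) \<times> (nat \<Rightarrow> 'a)"
  obtain p f where w: "w = (p, f)" by (cases w)
  show "w \<in> two_sided_shift -` (Pi UNIV A \<times> Pi UNIV B)
      \<longleftrightarrow> w \<in> Pi UNIV (\<lambda>k. A (Suc k)) \<times> Pi UNIV (case_nat (A 0) B)"
    unfolding w by (auto simp: two_sided_shift_def Pi_nat_iff[of "case_nat _ _"] Pi_nat_iff[of f])
qed

text \<open>
  After \<open>n\<close> steps the past of the image consists of the first \<open>n\<close> letters of the future in reversed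
  order, followed by the old past.
\<close>

lemma two_sided_shift_funpow_vimage_box:
  "(two_sided_shift ^^ n) -` (Pi UNIV A \<times> Pi UNIV B)
    = Pi UNIV (\<lambda>k. A (k + n)) \<times> Pi UNIV (\<lambda>k. if k < n then A (n - 1 - k) else B (k - n))"
proof (induction n)
  case 0
  show ?case by simp
next
  case (Suc n)
  have "(two_sided_shift ^^ Suc n) -` (Pi UNIV A \<times> Pi UNIV B)
      = two_sided_shift -` ((two_sided_shift ^^ n) -` (Pi UNIV A \<times> Pi UNIV B))"
    unfolding funpow_Suc_right vimage_comp ..
  also have "\<dots> = Pi UNIV (\<lambda>k. A (Suc k + n))
      \<times> Pi UNIV (case_nat (A n) (\<lambda>k. if k < n then A (n - 1 - k) else B (k - n)))"
    unfolding Suc two_sided_shift_vimage_box by simp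
  also have "case_nat (A n) (\<lambda>k. if k < n then A (n - 1 - k) else B (k - n))
      = (\<lambda>k. if k < Suc n then A (Suc n - 1 - k) else B (k - Suc n))"
    by (auto simp: fun_eq_iff split: nat.split)
  finally show ?case by simp
qed

lemma measurable_tail_seq:
  assumes "w \<in> N \<rightarrow>\<^sub>M (\<Pi>\<^sub>M i\<in>(UNIV :: nat set). M)"
  shows "(\<lambda>x k. w x (Suc k)) \<in> N \<rightarrow>\<^sub>M (\<Pi>\<^sub>M i\<in>(UNIV :: nat set). M)"
proof (rule measurable_PiM_single')
  show comp: "(\<lambda>x. w x (Suc k)) \<in> N \<rightarrow>\<^sub>M M" for k
    by (rule measurable_compose[OF assms measurable_component_singleton]) simp
  show "(\<lambda>x k. w x (Suc k)) \<in> space N \<rightarrow> (\<Pi>\<^sub>E i\<in>UNIV. space M)"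
    using measurable_space[OF comp] by auto
qed

context sequence_space
begin

text \<open>
  Finite-dimensional boxes are described by a full sequence of constraints that are trivial from
  some index on.  Intersections and shifts of boxes are then computed coordinatewise, without
  tracking finite index sets.
\<close>

definition full_from :: "nat \<Rightarrow> (nat \<Rightarrow> 'a set) \<Rightarrow> bool" where
  "full_from K A \<longleftrightarrow> (\<forall>k. A k \<in> sets M) \<and> (\<forall>k\<ge>K. A k = space M)"

lemma full_fromD: "full_from K A \<Longrightarrow> A k \<in> sets M" "full_from K A \<Longrightarrow> K \<le> k \<Longrightarrow> A k = space M"
  by (auto simp: full_from_def)

text \<open>
  The partial products in the formula for infinite boxes are constant from \<open>K\<close> on.
\<close>

lemma measure_box:
  assumes A: "full_from K A"
  shows "measure S (Pi UNIV A) = (\<Prod>k<K. measure M (A k))"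
proof (rule LIMSEQ_unique)
  show "(\<lambda>n. \<Prod>k\<le>n. measure M (A k)) \<longlonglongrightarrow> measure S (Pi UNIV A)"
    using A by (intro measure_PiM_countable) (rule full_fromD)
  have "(\<Prod>k\<le>n. measure M (A k)) = (\<Prod>k<K. measure M (A k))" if "n \<ge> K" for n
    using that full_fromD(2)[OF A] by (intro prod.mono_neutral_right) (auto simp: M.prob_space)
  then show "(\<lambda>n. \<Prod>k\<le>n. measure M (A k)) \<longlonglongrightarrow> (\<Prod>k<K. measure M (A k))"
    by (intro tendsto_eventually eventually_sequentiallyI[of K])
qed

lemma prod_algebra_eq_boxes:
  "prod_algebra UNIV (\<lambda>_. M) = {Pi UNIV A |A. \<exists>K. full_from K A}"
proof (intro set_eqI iffI)
  fix X assume "X \<in> prod_algebra UNIV (\<lambda>_::nat. M)"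
  then obtain J E where X: "X = emb UNIV J (Pi\<^sub>E J E)" "finite J" "\<And>i. i \<in> J \<Longrightarrow> E i \<in> sets M"
    by (elim prod_algebraE) auto
  let ?A = "\<lambda>k. if k \<in> J then E k else space M"
  obtain K where "J \<subseteq> {..<K}" using finite_nat_bounded[OF X(2)] by blast
  then have "full_from K ?A" using X(3) by (auto simp: full_from_def)
  moreover have "X = Pi UNIV ?A"
    using X(3)[THEN sets.sets_into_space]
    by (auto simp: X(1) prod_emb_def Pi_iff PiE_iff split: if_splits) (meson subsetD)
  ultimately show "X \<in> {Pi UNIV A |A. \<exists>K. full_from K A}" by blast
next
  fix X assume "X \<in> {Pi UNIV A |A. \<exists>K. full_from K A}"
  then obtain A K where X: "X = Pi UNIV A" "full_from K A" by blast
  have sub: "A k \<subseteq> space M" for k by (rule sets.sets_into_space[OF full_fromD(1)[OF X(2)]])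
  have "w k \<in> A k" if "w \<in> emb UNIV {..K} (Pi\<^sub>E {..K} A)" for w k
  proof (cases "k \<le> K")
    case True then show ?thesis using that by (auto simp: prod_emb_def PiE_iff)
  next
    case False
    then have "A k = space M" by (intro full_fromD(2)[OF X(2)]) simp
    then show ?thesis using that by (auto simp: prod_emb_def PiE_iff)
  qed
  moreover have "w \<in> emb UNIV {..K} (Pi\<^sub>E {..K} A)" if "\<And>k. w k \<in> A k" for w
    using that sub by (auto simp: prod_emb_def PiE_iff)
  ultimately have "X = emb UNIV {..K} (Pi\<^sub>E {..K} A)" unfolding X(1) by (auto simp: Pi_iff)
  then show "X \<in> prod_algebra UNIV (\<lambda>_. M)"
    using full_fromD(1)[OF X(2)] by (auto intro!: prod_algebraI)
qed

definition pair_boxes :: "((nat \<Rightarrow> 'a) \<times> (nat \<Rightarrow> 'a)) set set" where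
  "pair_boxes = {Pi UNIV A \<times> Pi UNIV B |A B. \<exists>K. full_from K A \<and> full_from K B}"

lemma full_from_mono: "full_from K A \<Longrightarrow> K \<le> L \<Longrightarrow> full_from L A"
  by (auto simp: full_from_def)

lemma full_from_Int: "full_from K A \<Longrightarrow> full_from K B \<Longrightarrow> full_from K (\<lambda>k. A k \<inter> B k)"
  by (auto simp: full_from_def)

lemma full_from_space: "full_from K (\<lambda>_. space M)"
  by (auto simp: full_from_def)

lemma pair_boxes_eq:
  "pair_boxes = {a \<times> b |a b. a \<in> prod_algebra UNIV (\<lambda>_. M) \<and> b \<in> prod_algebra UNIV (\<lambda>_. M)}"
proof -
  have "(\<exists>K. full_from K A \<and> full_from K B) \<longleftrightarrow> (\<exists>K. full_from K A) \<and> (\<exists>K. full_from K B)" for A B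
    by (meson full_from_mono nle_le)
  then show ?thesis unfolding pair_boxes_def prod_algebra_eq_boxes by blast
qed

lemma Int_stable_pair_boxes: "Int_stable pair_boxes"
proof (rule Int_stableI)
  fix P Q assume "P \<in> pair_boxes" "Q \<in> pair_boxes"
  then obtain A B K A' B' L where P: "P = Pi UNIV A \<times> Pi UNIV B" "full_from K A" "full_from K B"
    and Q: "Q = Pi UNIV A' \<times> Pi UNIV B'" "full_from L A'" "full_from L B'"
    unfolding pair_boxes_def by blast
  have "P \<inter> Q = Pi UNIV (\<lambda>k. A k \<inter> A' k) \<times> Pi UNIV (\<lambda>k. B k \<inter> B' k)"
    unfolding P(1) Q(1) by (auto simp: Pi_iff)
  moreover have "full_from (max K L) (\<lambda>k. A k \<inter> A' k)" "full_from (max K L) (\<lambda>k. B k \<inter> B' k)"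
    using P Q by (auto intro!: full_from_Int elim: full_from_mono)
  ultimately show "P \<inter> Q \<in> pair_boxes" unfolding pair_boxes_def by blast
qed

lemma space_S_eq: "space S = Pi UNIV (\<lambda>_. space M)"
  by (simp add: space_PiM PiE_UNIV_domain)

lemma pair_boxes_generate:
  "pair_boxes \<subseteq> Pow (space (S \<Otimes>\<^sub>M S))"
  "sets (S \<Otimes>\<^sub>M S) = sigma_sets (space (S \<Otimes>\<^sub>M S)) pair_boxes"
proof -
  let ?E = "prod_algebra UNIV (\<lambda>_::nat. M)"
  have E: "?E \<subseteq> Pow (space S)" "sets S = sigma_sets (space S) ?E"
    unfolding space_PiM by (rule prod_algebra_sets_into_space, rule sets_PiM)
  then show sub: "pair_boxes \<subseteq> Pow (space (S \<Otimes>\<^sub>M S))"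
    unfolding pair_boxes_eq space_pair_measure by blast
  have "space S \<in> ?E" unfolding prod_algebra_eq_boxes space_S_eq using full_from_space by blast
  then have "sets (S \<Otimes>\<^sub>M S) = sets (sigma (space S \<times> space S) pair_boxes)"
    unfolding pair_boxes_eq by (intro sets_pair_eq[OF E _ _ _ E, of "{space S}" "{space S}"]) auto
  then show "sets (S \<Otimes>\<^sub>M S) = sigma_sets (space (S \<Otimes>\<^sub>M S)) pair_boxes"
    using sub by (simp add: space_pair_measure)
qed

lemma measure_pair_box:
  assumes "full_from K A" "full_from L B"
  shows "measure (S \<Otimes>\<^sub>M S) (Pi UNIV A \<times> Pi UNIV B) = (\<Prod>k<K. measure M (A k)) * (\<Prod>k<L. measure M (B k))"
  using assms by (subst measure_pair_Times) (auto simp: measure_box full_fromD P.sigma_finite_measure_axioms)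

lemma two_sided_shift_measurable: "two_sided_shift \<in> S \<Otimes>\<^sub>M S \<rightarrow>\<^sub>M S \<Otimes>\<^sub>M S"
  unfolding two_sided_shift_def split_beta
proof (rule measurable_Pair)
  show "(\<lambda>w. case_nat (snd w 0) (fst w)) \<in> S \<Otimes>\<^sub>M S \<rightarrow>\<^sub>M S" by measurable
  show "(\<lambda>w k. snd w (Suc k)) \<in> S \<Otimes>\<^sub>M S \<rightarrow>\<^sub>M S" by (rule measurable_tail_seq) measurable
qed

text \<open>
  The shift moves one factor of the product formula for boxes from the past to the future.
\<close>

lemma two_sided_shift_measure_preserving: "measure_preserving_map (S \<Otimes>\<^sub>M S) two_sided_shift"
proof -
  interpret SS: pair_prob_space S S ..
  let ?D = "distr (S \<Otimes>\<^sub>M S) (S \<Otimes>\<^sub>M S) two_sided_shift"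
  interpret D: prob_space ?D by (rule SS.prob_space_distr[OF two_sided_shift_measurable])
  have "?D = S \<Otimes>\<^sub>M S"
  proof (rule measure_eqI_generator_eq[OF Int_stable_pair_boxes pair_boxes_generate(1)])
    fix X assume X: "X \<in> pair_boxes"
    then obtain A B K where AB: "X = Pi UNIV A \<times> Pi UNIV B" "full_from K A" "full_from K B"
      unfolding pair_boxes_def by blast
    have Xs: "X \<in> sets (S \<Otimes>\<^sub>M S)" using X unfolding pair_boxes_generate(2) by blast
    have full: "full_from K (\<lambda>k. A (Suc k))" "full_from (Suc K) (case_nat (A 0) B)" "full_from (Suc K) A"
      using AB by (auto simp: full_from_def split: nat.split)
    have pre: "two_sided_shift -` X = Pi UNIV (\<lambda>k. A (Suc k)) \<times> Pi UNIV (case_nat (A 0) B)"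
      unfolding AB(1) by (rule two_sided_shift_vimage_box)
    then have "two_sided_shift -` X \<in> pair_boxes"
      unfolding pair_boxes_def using full full_from_mono[OF full(1), of "Suc K"] by auto
    then have "two_sided_shift -` X \<inter> space (S \<Otimes>\<^sub>M S) = two_sided_shift -` X"
      using pair_boxes_generate(1) by blast
    then have "measure ?D X = measure (S \<Otimes>\<^sub>M S) (two_sided_shift -` X)"
      by (simp add: measure_distr[OF two_sided_shift_measurable Xs])
    also have "\<dots> = (\<Prod>k<K. measure M (A (Suc k))) * (\<Prod>k<Suc K. measure M (case_nat (A 0) B k))"
      unfolding pre by (rule measure_pair_box[OF full(1,2)])
    also have "\<dots> = (\<Prod>k<Suc K. measure M (A k)) * (\<Prod>k<K. measure M (B k))"
      by (simp only: prod.lessThan_Suc_shift) simp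
    also have "\<dots> = measure (S \<Otimes>\<^sub>M S) X"
      unfolding AB(1) by (rule measure_pair_box[symmetric, OF full(3) AB(3)])
    finally show "emeasure ?D X = emeasure (S \<Otimes>\<^sub>M S) X"
      by (simp add: D.emeasure_eq_measure SS.emeasure_eq_measure)
  next
    show "sets ?D = sigma_sets (space (S \<Otimes>\<^sub>M S)) pair_boxes"
      "sets (S \<Otimes>\<^sub>M S) = sigma_sets (space (S \<Otimes>\<^sub>M S)) pair_boxes"
      using pair_boxes_generate(2) by simp_all
    show "range (\<lambda>_::nat. space (S \<Otimes>\<^sub>M S)) \<subseteq> pair_boxes"
      unfolding pair_boxes_def space_pair_measure space_S_eq using full_from_space by blast
    show "(\<Union>_::nat. space (S \<Otimes>\<^sub>M S)) = space (S \<Otimes>\<^sub>M S)" by simp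
    show "emeasure ?D (space (S \<Otimes>\<^sub>M S)) \<noteq> \<infinity>" for i :: nat
      by (simp add: D.emeasure_eq_measure)
  qed
  then show ?thesis by (simp add: measure_preserving_map_def two_sided_shift_measurable)
qed

text \<open>
  Once \<open>n \<ge> K + L\<close>, the shifted box \<open>P\<close> constrains neither the past nor the first \<open>L\<close> future
  coordinates, while \<open>Q\<close> constrains only those.  In each future coordinate one of the two
  constraints is trivial, so the measure of the intersection is the product of the measures.
\<close>

theorem two_sided_shift_mixing: "mixing (S \<Otimes>\<^sub>M S) two_sided_shift"
proof -
  interpret SS: pair_prob_space S S ..
  note mp = two_sided_shift_measure_preserving
  show ?thesis
  proof (rule SS.mixing_from_generator[OF mp Int_stable_pair_boxes pair_boxes_generate])
    fix P Q assume PQ: "P \<in> pair_boxes" "Q \<in> pair_boxes"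
    then obtain A B K A' B' L where P: "P = Pi UNIV A \<times> Pi UNIV B" "full_from K A" "full_from K B"
      and Q: "Q = Pi UNIV A' \<times> Pi UNIV B'" "full_from L A'" "full_from L B'"
      unfolding pair_boxes_def by blast
    have Ps: "P \<in> SS.events" using PQ pair_boxes_generate(2) by auto
    have "SS.prob ((two_sided_shift ^^ n) -` P \<inter> Q) = SS.prob P * SS.prob Q" if n: "n \<ge> K + L" for n
    proof -
      define C where "C = (\<lambda>k. if k < n then A (n - 1 - k) else B (k - n))"
      have C: "full_from (n + K) C" using P by (auto simp: full_from_def C_def)
      \<comment> \<open>For \<open>k < L\<close> the index \<open>n - 1 - k\<close> is at least \<open>K\<close>, where \<open>A\<close> is trivial.\<close>
      have C_low: "C k = space M" if "k < L" for k
        unfolding C_def using that n by (auto intro!: full_fromD(2)[OF P(2)])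
      have AL: "A (k + n) = space M" for k using n by (intro full_fromD(2)[OF P(2)]) simp
      have pre: "(two_sided_shift ^^ n) -` P = Pi UNIV (\<lambda>_. space M) \<times> Pi UNIV C"
        unfolding P(1) two_sided_shift_funpow_vimage_box AL C_def ..
      have A': "A' k \<inter> space M = A' k" "B' k \<inter> space M = B' k" for k
        using sets.sets_into_space[OF full_fromD(1)] Q(2,3) by blast+
      have B'L: "full_from (n + K) B'" using full_from_mono[OF Q(3)] n by simp
      have inter: "(two_sided_shift ^^ n) -` P \<inter> Q = Pi UNIV A' \<times> Pi UNIV (\<lambda>k. B' k \<inter> C k)"
        unfolding pre Q(1) using A' by (fastforce simp: Pi_iff)
      have "measure M (B' k \<inter> C k) = measure M (B' k) * measure M (C k)" for k
      proof (cases "k < L")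
        case True
        then show ?thesis by (simp add: C_low A' M.prob_space)
      next
        case False
        then have "B' k = space M" by (intro full_fromD(2)[OF Q(3)]) simp
        moreover have "space M \<inter> C k = C k" using sets.sets_into_space[OF full_fromD(1)[OF C]] by blast
        ultimately show ?thesis by (simp add: M.prob_space)
      qed
      then have "SS.prob ((two_sided_shift ^^ n) -` P \<inter> Q)
          = (\<Prod>k<L. measure M (A' k)) * ((\<Prod>k<n + K. measure M (B' k)) * (\<Prod>k<n + K. measure M (C k)))"
        unfolding inter measure_pair_box[OF Q(2) full_from_Int[OF B'L C]] by (simp add: prod.distrib)
      \<comment> \<open>The product over \<open>C\<close> need not be evaluated: it is the measure of the preimage of \<open>P\<close>, hence that of \<open>P\<close>.\<close>
      also have "\<dots> = SS.prob Q * (\<Prod>k<n + K. measure M (C k))"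
        unfolding Q(1) measure_pair_box[OF Q(2) B'L] by simp
      also have "(\<Prod>k<n + K. measure M (C k)) = SS.prob P"
      proof -
        have "(\<Prod>k<n + K. measure M (C k)) = SS.prob ((two_sided_shift ^^ n) -` P)"
          unfolding pre measure_pair_box[OF full_from_space[of 0] C] by simp
        moreover have "(two_sided_shift ^^ n) -` P = (two_sided_shift ^^ n) -` P \<inter> space (S \<Otimes>\<^sub>M S)"
          unfolding pre space_pair_measure space_S_eq
          using sets.sets_into_space[OF full_fromD(1)[OF C]] by (auto simp: Pi_iff)
        ultimately show ?thesis
          using measure_preserving_mapD[OF measure_preserving_map_funpow[OF mp] Ps, of n] by simp
      qed
      finally show ?thesis by simp
    qed
    then show "(\<lambda>n. SS.prob ((two_sided_shift ^^ n) -` P \<inter> Q)) \<longlonglongrightarrow> SS.prob P * SS.prob Q"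
      by (intro tendsto_eventually eventually_sequentiallyI[of "K + L"])
  qed
qed

end

section \<open>The circle and its doubling map\<close>

lemma circle_proj_rep [simp]: "circle_proj (circle_rep x) = x"
proof transfer
  fix x :: real show "frac x - x \<in> \<int>" by (simp add: frac_def)
qed

lemma circle_rep_proj: "circle_rep (circle_proj r) = frac r"
  by transfer simp

lemma circle_rep_bounds: "0 \<le> circle_rep x" "circle_rep x < 1"
  by (transfer, simp add: frac_lt_1)+

lemma circle_rep_unique: "0 \<le> r \<Longrightarrow> r < 1 \<Longrightarrow> circle_rep (circle_proj r) = r"
  by (simp add: circle_rep_proj frac_eq)

lemma circle_proj_eqI: "r - s \<in> \<int> \<Longrightarrow> circle_proj r = circle_proj s"
  by transfer simp

lemma dist_circle_proj_le: "dist (circle_proj r) (circle_proj s) \<le> \<bar>r - s\<bar>"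
proof transfer
  fix r s :: real show "infdist (r - s) \<int> \<le> \<bar>r - s\<bar>" using infdist_Ints_le[of 0 "r - s"] by simp
qed

lemma dist_circle_le_rep: "dist x y \<le> \<bar>circle_rep x - circle_rep y\<bar>"
  using dist_circle_proj_le[of "circle_rep x" "circle_rep y"] by simp

lemma continuous_on_circle_proj: "continuous_on S circle_proj"
proof (rule continuous_on_iff[THEN iffD2], intro ballI allI impI exI conjI)
  fix r s e :: real assume "dist s r < e"
  then show "dist (circle_proj s) (circle_proj r) < e"
    using dist_circle_proj_le[of s r] by (simp add: dist_real_def)
qed

lemma circle_proj_measurable [measurable]: "circle_proj \<in> borel \<rightarrow>\<^sub>M borel"
  by (rule borel_measurable_continuous_onI[OF continuous_on_circle_proj])

text \<open>
  The representative jumps at \<open>0\<close>, but its sublevel sets are images of compact intervals.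
\<close>

lemma circle_rep_measurable [measurable]: "circle_rep \<in> borel_measurable borel"
proof (rule borel_measurableI_le)
  fix a :: real
  show "{x \<in> space borel. circle_rep x \<le> a} \<in> sets borel"
  proof (cases "a < 1")
    case True
    have "{x. circle_rep x \<le> a} = circle_proj ` {0..a}"
    proof (intro set_eqI iffI)
      fix x assume "x \<in> {x. circle_rep x \<le> a}"
      then have "x = circle_proj (circle_rep x)" "circle_rep x \<in> {0..a}"
        using circle_rep_bounds[of x] by auto
      then show "x \<in> circle_proj ` {0..a}" by (rule image_eqI)
    next
      fix x assume "x \<in> circle_proj ` {0..a}"
      then obtain r where r: "x = circle_proj r" "0 \<le> r" "r \<le> a" by auto
      then have "circle_rep x = r" using True by (simp add: circle_rep_unique)
      then show "x \<in> {x. circle_rep x \<le> a}" using r by simp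
    qed
    moreover have "closed (circle_proj ` {0..a})"
      by (intro compact_imp_closed compact_continuous_image continuous_on_circle_proj compact_Icc)
    ultimately show ?thesis by (simp add: borel_closed)
  next
    case False
    have "circle_rep x \<le> a" for x using False circle_rep_bounds(2)[of x] by linarith
    then have "{x. circle_rep x \<le> a} = UNIV" by simp
    then show ?thesis by simp
  qed
qed

lemma compact_UNIV_circle: "compact (UNIV :: circle set)"
proof -
  have "x \<in> circle_proj ` {0..1}" for x
    using circle_rep_bounds[of x] by (intro image_eqI[of _ _ "circle_rep x"]) auto
  then have "circle_proj ` {0..1} = (UNIV :: circle set)" by auto
  then show ?thesis
    using compact_continuous_image[OF continuous_on_circle_proj compact_Icc[of 0 1]] by simp
qed

definition binary_digit :: "circle \<Rightarrow> nat" where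
  "binary_digit x = (if circle_rep x < 1 / 2 then 0 else 1)"

lemma binary_digit_less: "binary_digit x < 2"
  by (simp add: binary_digit_def)

lemma doubling_eq: "doubling x = circle_proj (2 * circle_rep x)"
proof transfer
  fix x :: real
  have "2 * x - 2 * frac x = of_int (2 * \<lfloor>x\<rfloor>)" by (simp add: frac_def)
  then show "2 * x - 2 * frac x \<in> \<int>" by (metis Ints_of_int)
qed

lemma circle_rep_doubling: "circle_rep (doubling x) = 2 * circle_rep x - real (binary_digit x)"
proof -
  have "doubling x = circle_proj (2 * circle_rep x - real (binary_digit x))"
    unfolding doubling_eq by (rule circle_proj_eqI) simp
  then show ?thesis
    using circle_rep_bounds[of x]
    by (simp add: circle_rep_unique binary_digit_def split: if_splits)
qed

lemma inv_branch_doubling: "inv_branch (binary_digit x) (doubling x) = x"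
  by (simp add: inv_branch_def circle_rep_doubling diff_divide_distrib)

lemma circle_rep_inv_branch: "i < 2 \<Longrightarrow> circle_rep (inv_branch i x) = (circle_rep x + real i) / 2"
  using circle_rep_bounds[of x] unfolding inv_branch_def
  by (subst circle_rep_unique) (auto simp: less_2_cases_iff)

lemma binary_digit_inv_branch: "i < 2 \<Longrightarrow> binary_digit (inv_branch i x) = i"
  using circle_rep_bounds[of x]
  by (auto simp: binary_digit_def circle_rep_inv_branch less_2_cases_iff)

lemma doubling_inv_branch:
  assumes "i < 2"
  shows "doubling (inv_branch i x) = x"
proof -
  have "circle_rep (doubling (inv_branch i x)) = circle_rep x"
    using assms
    by (simp add: circle_rep_doubling circle_rep_inv_branch binary_digit_inv_branch add_divide_distrib)
  then have "circle_proj (circle_rep (doubling (inv_branch i x))) = circle_proj (circle_rep x)"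
    by (rule arg_cong)
  then show ?thesis by (simp only: circle_proj_rep)
qed

lemma doubling_measurable [measurable]: "doubling \<in> borel \<rightarrow>\<^sub>M borel"
  unfolding doubling_eq[abs_def] by measurable

lemma inv_branch_measurable [measurable]: "inv_branch i \<in> borel \<rightarrow>\<^sub>M borel"
  unfolding inv_branch_def[abs_def] by measurable

lemma sets_circle_lebesgue [simp, measurable_cong]: "sets circle_lebesgue = sets borel"
  by (simp add: circle_lebesgue_def)

lemma space_circle_lebesgue [simp]: "space circle_lebesgue = UNIV"
  by (simp add: circle_lebesgue_def)

lemma emeasure_circle_lebesgue:
  assumes "B \<in> sets borel"
  shows "emeasure circle_lebesgue B = emeasure lborel ({0..<1} \<inter> circle_proj -` B)"
proof -
  have "circle_proj -` B \<in> sets borel" using measurable_sets[OF circle_proj_measurable assms] by simp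
  then show ?thesis
    unfolding circle_lebesgue_def using assms by (simp add: emeasure_distr divide_ennreal_def)
qed

lemma prob_space_circle_lebesgue: "prob_space circle_lebesgue"
  by (rule prob_spaceI) (simp add: emeasure_circle_lebesgue)

lemma binary_digit_measurable: "binary_digit \<in> borel \<rightarrow>\<^sub>M uniform_count_measure {..<2}"
proof -
  have "binary_digit \<in> borel \<rightarrow>\<^sub>M count_space {..<2}"
    unfolding binary_digit_def[abs_def] by measurable
  then show ?thesis by (simp cong: measurable_cong_sets)
qed

text \<open>
  Lebesgue measure is self-similar: the part of \<open>B\<close> in either half of the circle is a copy, scaled by
  one half, of the preimage of \<open>B\<close> under the corresponding inverse branch.
\<close>

lemma emeasure_circle_lebesgue_half:
  assumes B: "B \<in> sets borel" and i: "i < 2"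
  shows "emeasure circle_lebesgue (B \<inter> {x. binary_digit x = i})
    = emeasure circle_lebesgue (inv_branch i -` B) / 2"
proof -
  have meas: "B \<inter> {x. binary_digit x = i} \<in> sets borel"
  proof -
    have "binary_digit -` {i} \<inter> space borel \<in> sets (borel :: circle measure)"
      by (rule measurable_sets[OF binary_digit_measurable]) (use i in \<open>simp add: sets_uniform_count_measure\<close>)
    moreover have "binary_digit -` {i} \<inter> space borel = {x. binary_digit x = i}" by auto
    ultimately show ?thesis using B by auto
  qed
  let ?X = "{0..<1} \<inter> circle_proj -` (B \<inter> {x. binary_digit x = i})"
  have X: "?X \<in> sets borel" using measurable_sets[OF circle_proj_measurable meas] by simp
  have ind: "indicator ?X (real i / 2 + 1 / 2 * r)
      = (indicator ({0..<1} \<inter> circle_proj -` inv_branch i -` B) r :: ennreal)" for r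
  proof -
    have "real i / 2 + 1 / 2 * r \<in> ?X \<longleftrightarrow> r \<in> {0..<1} \<inter> circle_proj -` inv_branch i -` B"
    proof (cases "r \<in> {0..<1}")
      case True
      then have "inv_branch i (circle_proj r) = circle_proj (real i / 2 + 1 / 2 * r)"
        by (simp add: inv_branch_def circle_rep_unique add.commute)
      then show ?thesis using True i binary_digit_inv_branch[OF i, of "circle_proj r"]
        by (auto simp: less_2_cases_iff)
    next
      case False
      then show ?thesis using i by (auto simp: binary_digit_def circle_rep_unique less_2_cases_iff split: if_splits)
    qed
    then show ?thesis by (simp add: indicator_def)
  qed
  have "emeasure lborel ?X = (\<integral>\<^sup>+r. indicator ?X r \<partial>lborel)" using X by simp
  also have "\<dots> = ennreal \<bar>1 / 2\<bar> * (\<integral>\<^sup>+r. indicator ?X (real i / 2 + 1 / 2 * r) \<partial>lborel)"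
    using X by (intro nn_integral_real_affine) auto
  also have "(\<integral>\<^sup>+r. indicator ?X (real i / 2 + 1 / 2 * r) \<partial>lborel)
      = (\<integral>\<^sup>+r. indicator ({0..<1} \<inter> circle_proj -` inv_branch i -` B) r \<partial>lborel)"
    by (simp only: ind)
  also have "(\<integral>\<^sup>+r. indicator ({0..<1} \<inter> circle_proj -` inv_branch i -` B) r \<partial>lborel)
      = emeasure lborel ({0..<1} \<inter> circle_proj -` inv_branch i -` B)"
  proof (rule nn_integral_indicator)
    have "inv_branch i -` B \<in> sets borel" using measurable_sets[OF inv_branch_measurable B] by simp
    from measurable_sets[OF circle_proj_measurable this]
    show "{0..<1} \<inter> circle_proj -` inv_branch i -` B \<in> sets lborel" by simp
  qed
  also have "\<dots> = emeasure circle_lebesgue (inv_branch i -` B)"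
    using measurable_sets[OF inv_branch_measurable B] by (simp add: emeasure_circle_lebesgue)
  also have "ennreal \<bar>1 / 2\<bar> = inverse 2"
  proof -
    have "ennreal \<bar>1 / 2\<bar> = ennreal (inverse 2)" by (rule arg_cong) simp
    also have "\<dots> = inverse (ennreal 2)" by (rule inverse_ennreal[symmetric]) simp
    finally show ?thesis by (simp only: ennreal_numeral)
  qed
  finally show ?thesis
    using emeasure_circle_lebesgue[OF meas] by (simp add: divide_ennreal_def mult.commute)
qed

section \<open>Binary digits and the baker's map\<close>

definition binary_digits :: "circle \<Rightarrow> nat \<Rightarrow> nat" where
  "binary_digits x k = binary_digit ((doubling ^^ k) x)"

lemma binary_digits_0: "binary_digits x 0 = binary_digit x"
  by (simp add: binary_digits_def)

lemma binary_digits_Suc: "binary_digits x (Suc k) = binary_digits (doubling x) k"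
  by (simp add: binary_digits_def funpow_swap1)

lemma binary_digits_measurable: "binary_digits \<in> borel \<rightarrow>\<^sub>M bernoulli_uniform 2"
  unfolding bernoulli_uniform_def
proof (rule measurable_PiM_single')
  have "doubling ^^ k \<in> borel \<rightarrow>\<^sub>M borel" for k by (rule measurable_funpow) measurable
  then show "(\<lambda>x. binary_digits x k) \<in> borel \<rightarrow>\<^sub>M uniform_count_measure {..<2}" for k
    unfolding binary_digits_def by (rule measurable_compose[OF _ binary_digit_measurable])
  show "(\<lambda>x k. binary_digits x k) \<in> space borel \<rightarrow> (\<Pi>\<^sub>E k\<in>UNIV. space (uniform_count_measure {..<2}))"
    by (auto simp: binary_digits_def binary_digit_less space_uniform_count_measure)
qed

lemma measure_circle_lebesgue_split:
  assumes B: "B \<in> sets borel"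
  shows "measure circle_lebesgue B
    = (measure circle_lebesgue (inv_branch 0 -` B) + measure circle_lebesgue (inv_branch 1 -` B)) / 2"
proof -
  interpret prob_space circle_lebesgue by (rule prob_space_circle_lebesgue)
  have half: "B \<inter> {x. binary_digit x = i} \<in> sets borel"
    "measure circle_lebesgue (B \<inter> {x. binary_digit x = i}) = measure circle_lebesgue (inv_branch i -` B) / 2"
    if "i < 2" for i
  proof -
    have "binary_digit -` {i} \<inter> space borel \<in> sets (borel :: circle measure)"
      by (rule measurable_sets[OF binary_digit_measurable]) (use that in \<open>simp add: sets_uniform_count_measure\<close>)
    moreover have "binary_digit -` {i} \<inter> space borel = {x. binary_digit x = i}" by auto
    ultimately show "B \<inter> {x. binary_digit x = i} \<in> sets borel" using B by auto
    have "ennreal (measure circle_lebesgue (B \<inter> {x. binary_digit x = i}))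
        = ennreal (measure circle_lebesgue (inv_branch i -` B)) / 2"
      using emeasure_circle_lebesgue_half[OF B that] by (simp only: emeasure_eq_measure)
    also have "\<dots> = ennreal (measure circle_lebesgue (inv_branch i -` B) / 2)"
      by (rule ennreal_divide_numeral) simp
    finally show "measure circle_lebesgue (B \<inter> {x. binary_digit x = i})
        = measure circle_lebesgue (inv_branch i -` B) / 2"
      by (subst (asm) ennreal_inj) simp_all
  qed
  let ?X = "\<lambda>i. B \<inter> {x. binary_digit x = i}"
  have "B = ?X 0 \<union> ?X 1"
    using binary_digit_less by (auto simp: less_2_cases_iff)
  then have "measure circle_lebesgue B = measure circle_lebesgue (?X 0 \<union> ?X 1)"
    by (rule arg_cong)
  also have "\<dots> = measure circle_lebesgue (?X 0) + measure circle_lebesgue (?X 1)"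
    by (rule finite_measure_Union) (use half(1)[of 0] half(1)[of 1] in auto)
  finally show ?thesis
    using half(2)[of 0] half(2)[of 1] by simp
qed

lemma binary_digits_component_sets:
  assumes "A \<subseteq> {..<2}"
  shows "{x. binary_digits x k \<in> A} \<in> sets borel"
proof -
  have "(\<lambda>x. binary_digits x k) -` A \<inter> space borel \<in> sets borel"
  proof (rule measurable_sets)
    show "(\<lambda>x. binary_digits x k) \<in> borel \<rightarrow>\<^sub>M uniform_count_measure {..<2}"
      using measurable_compose[OF binary_digits_measurable[unfolded bernoulli_uniform_def]
          measurable_component_singleton[of k]] by simp
  qed (use assms in \<open>simp add: sets_uniform_count_measure\<close>)
  moreover have "(\<lambda>x. binary_digits x k) -` A \<inter> space borel = {x. binary_digits x k \<in> A}" by auto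
  ultimately show ?thesis by simp
qed

lemma binary_digits_box_sets:
  assumes "\<And>k. A k \<subseteq> {..<2}"
  shows "{x. \<forall>k<n. binary_digits x k \<in> A k} \<in> sets borel"
proof -
  have "{x \<in> space borel. binary_digits x k \<in> A k} \<in> sets borel" for k
    using binary_digits_component_sets[OF assms[of k], of k] by simp
  then have "{x \<in> space borel. \<forall>k\<in>{..<n}. binary_digits x k \<in> A k} \<in> sets borel"
    by (rule sets.sets_Collect_finite_All) (rule finite_lessThan)
  then show ?thesis by (simp only: lessThan_iff space_borel Ball_def UNIV_I simp_thms)
qed

text \<open>
  Induction on the number of digits: splitting the circle into its halves decides the first digit,
  and the inverse branches turn the remaining digits into the digits of a uniformly distributed point.
\<close>

lemma measure_binary_digits_box:
  assumes "\<And>k. A k \<subseteq> {..<2}"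
  shows "measure circle_lebesgue {x. \<forall>k<n. binary_digits x k \<in> A k} = (\<Prod>k<n. real (card (A k)) / 2)"
  using assms
proof (induction n arbitrary: A)
  case 0
  show ?case using prob_space.prob_space[OF prob_space_circle_lebesgue] by simp
next
  case (Suc n)
  let ?B = "{x. \<forall>k<Suc n. binary_digits x k \<in> A k}"
  let ?B' = "{x. \<forall>k<n. binary_digits x k \<in> A (Suc k)}"
  have B_iff: "x \<in> ?B \<longleftrightarrow> binary_digit x \<in> A 0 \<and> doubling x \<in> ?B'" for x
    by (auto simp: less_Suc_eq_0_disj binary_digits_0 binary_digits_Suc)
  have pre: "inv_branch i -` ?B = (if i \<in> A 0 then ?B' else {})" if "i < 2" for i
    unfolding vimage_def B_iff binary_digit_inv_branch[OF that] doubling_inv_branch[OF that] by auto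
  have A0: "A 0 = (if 0 \<in> A 0 then {0} else {}) \<union> (if 1 \<in> A 0 then {1} else {})"
    using Suc.prems[of 0] by (auto simp: less_2_cases_iff subset_eq)
  have card: "card (A 0) = (if 0 \<in> A 0 then 1 else 0) + (if 1 \<in> A 0 then 1 else 0)"
    using arg_cong[OF A0, of card] by (cases "0 \<in> A 0"; cases "1 \<in> A 0") simp_all
  have "measure circle_lebesgue ?B
      = (measure circle_lebesgue (inv_branch 0 -` ?B) + measure circle_lebesgue (inv_branch 1 -` ?B)) / 2"
    by (rule measure_circle_lebesgue_split[OF binary_digits_box_sets[OF Suc.prems]])
  also have "\<dots> = real (card (A 0)) / 2 * measure circle_lebesgue ?B'"
  proof -
    have "measure circle_lebesgue (inv_branch i -` ?B) = (if i \<in> A 0 then measure circle_lebesgue ?B' else 0)"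
      if "i < 2" for i
      unfolding pre[OF that] by simp
    from this[of 0] this[of 1] show ?thesis unfolding card by simp
  qed
  also have "measure circle_lebesgue ?B' = (\<Prod>k<n. real (card (A (Suc k))) / 2)"
    by (rule Suc.IH) (rule Suc.prems)
  finally show ?case by (simp only: prod.lessThan_Suc_shift)
qed

lemma sequence_space_uniform:
  assumes "m > 0"
  shows "sequence_space (uniform_count_measure {..<m :: nat})"
proof -
  interpret prob_space "uniform_count_measure {..<m}"
    by (rule prob_space_uniform_count_measure) (use assms in auto)
  show ?thesis by unfold_locales
qed

text \<open>
  Boxes of digits have the measures prescribed by the product formula, and this formula
  characterises the Bernoulli measure.
\<close>

lemma distr_binary_digits: "distr circle_lebesgue (bernoulli_uniform 2) binary_digits = bernoulli_uniform 2"
proof -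
  interpret prob_space circle_lebesgue by (rule prob_space_circle_lebesgue)
  let ?U = "uniform_count_measure {..<2::nat}"
  interpret U: sequence_space ?U by (rule sequence_space_uniform) simp
  have m: "binary_digits \<in> circle_lebesgue \<rightarrow>\<^sub>M U.S"
    using binary_digits_measurable by (simp add: bernoulli_uniform_def cong: measurable_cong_sets)
  have "distr circle_lebesgue U.S binary_digits = U.S"
  proof (rule U.PiM_eq)
    fix J F assume J: "finite J" "J \<subseteq> (UNIV :: nat set)" "\<And>j. j \<in> J \<Longrightarrow> F j \<in> sets ?U"
    obtain n where n: "J \<subseteq> {..<n}" using finite_nat_bounded[OF J(1)] by blast
    let ?A = "\<lambda>k. if k \<in> J then F k else {..<2}"
    have F: "F j \<subseteq> {..<2}" if "j \<in> J" for j using J(3)[OF that] by (simp add: sets_uniform_count_measure)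
    then have A: "?A k \<subseteq> {..<2}" for k by auto
    have "binary_digits -` U.emb UNIV J (Pi\<^sub>E J F) \<inter> space circle_lebesgue
        = {x. \<forall>k<n. binary_digits x k \<in> ?A k}"
      using subsetD[OF n] binary_digit_less by (auto simp: prod_emb_def PiE_iff binary_digits_def space_uniform_count_measure)
    moreover have "U.emb UNIV J (Pi\<^sub>E J F) \<in> sets U.S" using J by (auto intro!: sets_PiM_I)
    ultimately have "emeasure (distr circle_lebesgue U.S binary_digits) (U.emb UNIV J (Pi\<^sub>E J F))
        = ennreal (\<Prod>k<n. real (card (?A k)) / 2)"
      by (simp only: emeasure_distr[OF m] emeasure_eq_measure measure_binary_digits_box[OF A])
    also have "(\<Prod>k<n. real (card (?A k)) / 2) = (\<Prod>k\<in>J. real (card (F k)) / 2)"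
      using n by (intro prod.mono_neutral_cong_right) auto
    also have "ennreal \<dots> = (\<Prod>k\<in>J. emeasure ?U (F k))"
      using F by (subst prod_ennreal[symmetric]) (auto simp: emeasure_uniform_count_measure intro!: prod.cong)
    finally show "emeasure (distr circle_lebesgue U.S binary_digits) (U.emb UNIV J (Pi\<^sub>E J F))
        = (\<Prod>k\<in>J. emeasure ?U (F k))" .
  qed simp
  then show ?thesis by (simp add: bernoulli_uniform_def)
qed

definition from_binary_digits :: "(nat \<Rightarrow> nat) \<Rightarrow> circle" where
  "from_binary_digits d = circle_proj (\<Sum>k. real (d k) / 2 ^ Suc k)"

text \<open>
  By induction, the first \<open>n\<close> digits leave the remainder \<open>circle_rep ((doubling ^^ n) x) / 2 ^ n\<close>.
\<close>

lemma binary_expansion_sums: "(\<lambda>k. real (binary_digits x k) / 2 ^ Suc k) sums circle_rep x"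
proof -
  have part: "(\<Sum>k<n. real (binary_digits x k) / 2 ^ Suc k) = circle_rep x - circle_rep ((doubling ^^ n) x) / 2 ^ n" for n
  proof (induction n)
    case (Suc n)
    then show ?case by (simp add: binary_digits_def circle_rep_doubling field_simps)
  qed simp
  have "(\<lambda>n. circle_rep ((doubling ^^ n) x) / 2 ^ n) \<longlonglongrightarrow> 0"
  proof (rule tendsto_sandwich[of "\<lambda>_. 0" _ _ "\<lambda>n. (1 / 2) ^ n"])
    show "(\<lambda>n. (1 / 2) ^ n) \<longlonglongrightarrow> (0 :: real)" by (rule LIMSEQ_power_zero) simp
    show "\<forall>\<^sub>F n in sequentially. 0 \<le> circle_rep ((doubling ^^ n) x) / 2 ^ n"
      by (simp add: circle_rep_bounds)
    have "circle_rep ((doubling ^^ n) x) / 2 ^ n \<le> (1 / 2) ^ n" for n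
      using circle_rep_bounds(2)[of "(doubling ^^ n) x"] by (simp add: power_divide divide_right_mono)
    then show "\<forall>\<^sub>F n in sequentially. circle_rep ((doubling ^^ n) x) / 2 ^ n \<le> (1 / 2) ^ n" by simp
  qed simp
  then have "(\<lambda>n. circle_rep x - circle_rep ((doubling ^^ n) x) / 2 ^ n) \<longlonglongrightarrow> circle_rep x - 0"
    by (intro tendsto_intros)
  then show ?thesis unfolding sums_def part by simp
qed

text \<open>
  A point is recovered from its digits without exception.  Only the other composition fails,
  on the null set of expansions ending in ones, and it is avoided below.
\<close>

lemma from_binary_digits_inverse: "from_binary_digits (binary_digits x) = x"
  unfolding from_binary_digits_def sums_unique[OF binary_expansion_sums, symmetric] by simp

lemma bernoulli_component_measurable:
  "(\<lambda>w. w k) \<in> bernoulli_uniform m \<rightarrow>\<^sub>M count_space {..<m}"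
proof -
  have "(\<lambda>w. w k) \<in> bernoulli_uniform m \<rightarrow>\<^sub>M uniform_count_measure {..<m}"
    unfolding bernoulli_uniform_def by (rule measurable_component_singleton) simp
  then show ?thesis unfolding measurable_cong_sets[OF refl sets_uniform_count_measure_count_space] .
qed

lemma from_binary_digits_measurable: "from_binary_digits \<in> bernoulli_uniform m \<rightarrow>\<^sub>M borel"
proof -
  have "(\<lambda>d. real (d k)) \<in> bernoulli_uniform m \<rightarrow>\<^sub>M borel" for k
    by (rule measurable_compose[OF bernoulli_component_measurable]) simp
  then have "(\<lambda>d. \<Sum>k. real (d k) / 2 ^ Suc k) \<in> bernoulli_uniform m \<rightarrow>\<^sub>M borel"
    by (intro borel_measurable_suminf borel_measurable_divide) simp_all
  then show ?thesis
    unfolding from_binary_digits_def[abs_def] by (rule measurable_compose[OF _ circle_proj_measurable])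
qed

lemma two_sided_shift_bernoulli_mixing:
  assumes "m > 0"
  shows "mixing (bernoulli_uniform m \<Otimes>\<^sub>M bernoulli_uniform m) two_sided_shift"
  unfolding bernoulli_uniform_def
  by (rule sequence_space.two_sided_shift_mixing[OF sequence_space_uniform[OF assms]])

lemma prob_space_bernoulli_uniform:
  assumes "m > 0"
  shows "prob_space (bernoulli_uniform m)"
  unfolding bernoulli_uniform_def
  by (rule prob_space_PiM) (rule prob_space_uniform_count_measure, use assms in auto)

text \<open>
  The past comes first, to match the order (past, future) of the two-sided shift.
\<close>

definition baker :: "(nat \<Rightarrow> nat) \<times> circle \<Rightarrow> (nat \<Rightarrow> nat) \<times> circle" where
  "baker = (\<lambda>(a, x). (case_nat (binary_digit x) a, doubling x))"

text \<open>
  Replacing the point by its digits carries the baker's map to the two-sided shift on bits, carries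
  the measure to the Bernoulli measure, and loses no event because the digits determine the point.
  Thus mixing lifts from the shift to the baker's map.
\<close>

theorem baker_mixing: "mixing (bernoulli_uniform 2 \<Otimes>\<^sub>M circle_lebesgue) baker"
proof -
  let ?\<beta> = "bernoulli_uniform 2"
  let ?\<pi> = "\<lambda>(a, x). (a :: nat \<Rightarrow> nat, binary_digits x)"
  let ?\<rho> = "\<lambda>(a, d). (a :: nat \<Rightarrow> nat, from_binary_digits d)"
  interpret \<beta>: prob_space ?\<beta> by (rule prob_space_bernoulli_uniform) simp
  have dig: "binary_digits \<in> circle_lebesgue \<rightarrow>\<^sub>M ?\<beta>"
    using binary_digits_measurable by (simp cong: measurable_cong_sets)
  have "distr ?\<beta> ?\<beta> (\<lambda>a. a) \<Otimes>\<^sub>M distr circle_lebesgue ?\<beta> binary_digits = distr (?\<beta> \<Otimes>\<^sub>M circle_lebesgue) (?\<beta> \<Otimes>\<^sub>M ?\<beta>) ?\<pi>"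
    by (rule pair_measure_distr[OF measurable_ident_sets[OF refl] dig])
      (unfold distr_binary_digits, unfold_locales)
  then have distr: "distr (?\<beta> \<Otimes>\<^sub>M circle_lebesgue) (?\<beta> \<Otimes>\<^sub>M ?\<beta>) ?\<pi> = ?\<beta> \<Otimes>\<^sub>M ?\<beta>"
    by (simp add: distr_binary_digits distr_id)
  have \<pi>: "?\<pi> \<in> ?\<beta> \<Otimes>\<^sub>M circle_lebesgue \<rightarrow>\<^sub>M ?\<beta> \<Otimes>\<^sub>M ?\<beta>"
    unfolding split_beta by (intro measurable_Pair measurable_fst measurable_compose[OF measurable_snd dig])
  have \<rho>: "?\<rho> \<in> ?\<beta> \<Otimes>\<^sub>M ?\<beta> \<rightarrow>\<^sub>M ?\<beta> \<Otimes>\<^sub>M circle_lebesgue"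
    unfolding split_beta
    by (intro measurable_Pair measurable_fst measurable_compose[OF measurable_snd])
      (use from_binary_digits_measurable in \<open>simp cong: measurable_cong_sets\<close>)
  have comm: "?\<pi> (baker w) = two_sided_shift (?\<pi> w)" for w
    by (cases w) (auto simp: baker_def two_sided_shift_def binary_digits_0 binary_digits_Suc)
  have "?\<rho> (two_sided_shift (?\<pi> w)) = baker w" for w
    unfolding comm[symmetric] by (cases "baker w") (simp add: from_binary_digits_inverse)
  then have baker_eq: "baker = (\<lambda>w. ?\<rho> (two_sided_shift (?\<pi> w)))" by (simp add: fun_eq_iff)
  have "two_sided_shift \<in> ?\<beta> \<Otimes>\<^sub>M ?\<beta> \<rightarrow>\<^sub>M ?\<beta> \<Otimes>\<^sub>M ?\<beta>"
    using mixingD(1)[OF two_sided_shift_bernoulli_mixing[of 2]] by (simp add: measure_preserving_map_def)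
  then have baker: "baker \<in> ?\<beta> \<Otimes>\<^sub>M circle_lebesgue \<rightarrow>\<^sub>M ?\<beta> \<Otimes>\<^sub>M circle_lebesgue"
    unfolding baker_eq by (intro measurable_compose[OF \<pi>] measurable_compose[OF _ \<rho>])
  show ?thesis
  proof (rule mixing_extension[OF _ \<pi> baker comm])
    show "mixing (distr (?\<beta> \<Otimes>\<^sub>M circle_lebesgue) (?\<beta> \<Otimes>\<^sub>M ?\<beta>) ?\<pi>) two_sided_shift"
      unfolding distr by (rule two_sided_shift_bernoulli_mixing) simp
  next
    fix A assume A: "A \<in> sets (?\<beta> \<Otimes>\<^sub>M circle_lebesgue)"
    let ?A' = "?\<rho> -` A \<inter> space (?\<beta> \<Otimes>\<^sub>M ?\<beta>)"
    have "?\<rho> (?\<pi> w) = w" for w by (cases w) (simp add: from_binary_digits_inverse)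
    then have "A = ?\<pi> -` ?A' \<inter> space (?\<beta> \<Otimes>\<^sub>M circle_lebesgue)"
      using sets.sets_into_space[OF A] measurable_space[OF \<pi>] by auto
    then show "\<exists>A'\<in>sets (?\<beta> \<Otimes>\<^sub>M ?\<beta>). A = ?\<pi> -` A' \<inter> space (?\<beta> \<Otimes>\<^sub>M circle_lebesgue)"
      using measurable_sets[OF \<rho> A] by blast
  qed
qed

section \<open>The random SRB measure as a factor of a Bernoulli shift\<close>

text \<open>
  Tonelli's theorem.  It regroups the four factors of the measure that defines the random SRB measure
  into the phase space of the baker's map times that of the shift on letters.
\<close>

lemma distr_pair_swap_assoc:
  assumes "sigma_finite_measure P" "sigma_finite_measure Q" "sigma_finite_measure R"
  shows "distr ((Q \<Otimes>\<^sub>M P) \<Otimes>\<^sub>M R) (P \<Otimes>\<^sub>M (Q \<Otimes>\<^sub>M R)) (\<lambda>w. (snd (fst w), fst (fst w), snd w)) = P \<Otimes>\<^sub>M (Q \<Otimes>\<^sub>M R)"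
proof (rule measure_eqI)
  interpret P: sigma_finite_measure P by fact
  interpret Q: sigma_finite_measure Q by fact
  interpret R: sigma_finite_measure R by fact
  interpret QP: pair_sigma_finite Q P ..
  interpret QR: pair_sigma_finite Q R ..
  let ?h = "\<lambda>w. (snd (fst w), fst (fst w), snd w)"
  fix E assume "E \<in> sets (distr ((Q \<Otimes>\<^sub>M P) \<Otimes>\<^sub>M R) (P \<Otimes>\<^sub>M (Q \<Otimes>\<^sub>M R)) ?h)"
  then have E [measurable]: "E \<in> sets (P \<Otimes>\<^sub>M (Q \<Otimes>\<^sub>M R))" by simp
  have h: "?h \<in> (Q \<Otimes>\<^sub>M P) \<Otimes>\<^sub>M R \<rightarrow>\<^sub>M P \<Otimes>\<^sub>M (Q \<Otimes>\<^sub>M R)" by measurable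
  have "emeasure (distr ((Q \<Otimes>\<^sub>M P) \<Otimes>\<^sub>M R) (P \<Otimes>\<^sub>M (Q \<Otimes>\<^sub>M R)) ?h) E
      = (\<integral>\<^sup>+w. indicator E w \<partial>distr ((Q \<Otimes>\<^sub>M P) \<Otimes>\<^sub>M R) (P \<Otimes>\<^sub>M (Q \<Otimes>\<^sub>M R)) ?h)"
    by simp
  also have "\<dots> = (\<integral>\<^sup>+w. indicator E (?h w) \<partial>((Q \<Otimes>\<^sub>M P) \<Otimes>\<^sub>M R))"
    by (rule nn_integral_distr[OF h]) measurable
  also have "\<dots> = (\<integral>\<^sup>+v. \<integral>\<^sup>+r. indicator E (?h (v, r)) \<partial>R \<partial>(Q \<Otimes>\<^sub>M P))"
    by (rule R.nn_integral_fst[symmetric]) measurable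
  also have "\<dots> = (\<integral>\<^sup>+p. \<integral>\<^sup>+q. \<integral>\<^sup>+r. indicator E (p, q, r) \<partial>R \<partial>Q \<partial>P)"
  proof -
    have "(\<lambda>v. \<integral>\<^sup>+r. indicator E (snd v, fst v, r) \<partial>R) \<in> borel_measurable (Q \<Otimes>\<^sub>M P)"
      by measurable
    from QP.nn_integral_snd[OF this] show ?thesis by simp
  qed
  also have "\<dots> = (\<integral>\<^sup>+p. \<integral>\<^sup>+v. indicator E (p, v) \<partial>(Q \<Otimes>\<^sub>M R) \<partial>P)"
    by (intro nn_integral_cong R.nn_integral_fst) measurable
  also have "\<dots> = (\<integral>\<^sup>+w. indicator E w \<partial>(P \<Otimes>\<^sub>M (Q \<Otimes>\<^sub>M R)))"
  proof -
    have "sigma_finite_measure (Q \<Otimes>\<^sub>M R)" by unfold_locales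
    then show ?thesis by (rule sigma_finite_measure.nn_integral_fst) measurable
  qed
  also have "\<dots> = emeasure (P \<Otimes>\<^sub>M (Q \<Otimes>\<^sub>M R)) E" by simp
  finally show "emeasure (distr ((Q \<Otimes>\<^sub>M P) \<Otimes>\<^sub>M R) (P \<Otimes>\<^sub>M (Q \<Otimes>\<^sub>M R)) ?h) E
      = emeasure (P \<Otimes>\<^sub>M (Q \<Otimes>\<^sub>M R)) E" .
qed simp

lemma inv_word_Suc_left: "inv_word a (Suc n) x = inv_word (\<lambda>k. a (Suc k)) n (inv_branch (a 0) x)"
  by (induction n) simp_all

text \<open>
  The branch belonging to the leading digit of \<open>x\<close> undoes the doubling map at \<open>x\<close>.
\<close>

lemma inv_word_doubling: "inv_word (case_nat (binary_digit x) a) (Suc n) (doubling x) = inv_word a n x"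
  unfolding inv_word_Suc_left by (simp add: inv_branch_doubling)

lemma inv_word_measurable:
  assumes x: "x \<in> N \<rightarrow>\<^sub>M borel" and a: "a \<in> N \<rightarrow>\<^sub>M bernoulli_uniform 2"
  shows "(\<lambda>w. inv_word (a w) n (x w)) \<in> N \<rightarrow>\<^sub>M borel"
proof (induction n)
  case 0
  show ?case using x by simp
next
  case (Suc n)
  have a_n: "(\<lambda>w. a w n) \<in> N \<rightarrow>\<^sub>M count_space {..<2}"
    by (rule measurable_compose[OF a bernoulli_component_measurable])
  have "(\<lambda>w. inv_branch i (inv_word (a w) n (x w))) \<in> N \<rightarrow>\<^sub>M borel" for i
    by (rule measurable_compose[OF Suc inv_branch_measurable])
  from measurable_compose_countable'[OF this a_n countable_finite[OF finite_lessThan]]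
  show ?case by simp
qed

text \<open>
  The bound \<open>C\<close> makes the series for the fibre coordinate converge geometrically and confines the
  dynamics to a compact set; measurability of the \<open>A c\<close> makes \<open>\<Psi>\<close> and the skew product measurable.
\<close>

locale random_skew =
  fixes m :: nat and l :: real and A :: "nat \<Rightarrow> circle \<Rightarrow> real" and C :: real
  assumes m: "m > 0" and l: "0 < l" "l < 1"
    and A_measurable: "\<And>c. c < m \<Longrightarrow> A c \<in> borel_measurable borel"
    and A_bound: "\<And>c x. c < m \<Longrightarrow> \<bar>A c x\<bar> \<le> C"
begin

abbreviation "\<beta> \<equiv> bernoulli_uniform m"
abbreviation "\<beta>2 \<equiv> bernoulli_uniform 2"
abbreviation target :: "(circle \<times> real \<times> (nat \<Rightarrow> nat)) measure" where "target \<equiv> borel \<Otimes>\<^sub>M borel \<Otimes>\<^sub>M \<beta>"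
abbreviation "\<mu> \<equiv> random_SRB m A l"
abbreviation "G \<equiv> skew A l"

lemma space_\<beta>_iff: "w \<in> space \<beta> \<longleftrightarrow> (\<forall>k. w k < m)"
  by (auto simp: bernoulli_uniform_def space_PiM PiE_UNIV_domain space_uniform_count_measure)

lemma S_sum_term_bound:
  assumes "c \<in> space \<beta>"
  shows "\<bar>l ^ i * A (c i) y\<bar> \<le> C * l ^ i"
proof -
  have "c i < m" using assms by (simp add: space_\<beta>_iff)
  then have "\<bar>A (c i) y\<bar> \<le> C" by (rule A_bound)
  then have "\<bar>A (c i) y\<bar> * l ^ i \<le> C * l ^ i" using l by (intro mult_right_mono) simp_all
  then show ?thesis using l by (simp add: abs_mult mult.commute)
qed

lemma geometric_bound_sums: "(\<lambda>i. C * l ^ i) sums (C * (1 / (1 - l)))"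
  by (rule sums_mult, rule geometric_sums) (use l in simp)

lemma S_sum_summable:
  assumes "c \<in> space \<beta>"
  shows "summable (\<lambda>i. l ^ i * A (c i) (inv_word a (Suc i) x))"
  by (rule summable_comparison_test'[OF sums_summable[OF geometric_bound_sums], of 0]) (simp only: real_norm_def S_sum_term_bound[OF assms])

lemma S_sum_bound:
  assumes "c \<in> space \<beta>"
  shows "\<bar>S_sum A l x c a\<bar> \<le> C / (1 - l)"
proof -
  have "\<bar>S_sum A l x c a\<bar> \<le> (\<Sum>i. C * l ^ i)"
    unfolding S_sum_def real_norm_def[symmetric]
    by (rule norm_suminf_le[OF _ sums_summable[OF geometric_bound_sums]]) (simp only: real_norm_def S_sum_term_bound[OF assms])
  also have "\<dots> = C * (1 / (1 - l))"
    by (rule sums_unique[symmetric, OF geometric_bound_sums])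
  finally show ?thesis by simp
qed

text \<open>
  The equation that makes \<open>\<Psi>\<close> intertwine the dynamics: the first term of the series at the new point
  is \<open>A b x\<close>, and the rest is the old series multiplied by \<open>l\<close>.
\<close>

lemma S_sum_doubling:
  assumes c: "c \<in> space \<beta>" and b: "b < m"
  shows "S_sum A l (doubling x) (case_nat b c) (case_nat (binary_digit x) a) = A b x + l * S_sum A l x c a"
proof -
  have "case_nat b c \<in> space \<beta>" using c b by (auto simp: space_\<beta>_iff split: nat.split)
  from suminf_split_head[OF S_sum_summable[OF this, of "case_nat (binary_digit x) a" "doubling x"]]
  have "S_sum A l (doubling x) (case_nat b c) (case_nat (binary_digit x) a)
      = A b x + (\<Sum>i. l ^ Suc i * A (c i) (inv_word a (Suc i) x))"
    unfolding S_sum_def inv_word_doubling by simp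
  also have "(\<Sum>i. l ^ Suc i * A (c i) (inv_word a (Suc i) x)) = l * S_sum A l x c a"
    unfolding S_sum_def using suminf_mult[OF S_sum_summable[OF c], of l a x] by (simp add: mult.assoc)
  finally show ?thesis .
qed

lemma S_sum_measurable:
  assumes x: "x \<in> N \<rightarrow>\<^sub>M borel" and c: "c \<in> N \<rightarrow>\<^sub>M \<beta>" and a: "a \<in> N \<rightarrow>\<^sub>M \<beta>2"
  shows "(\<lambda>w. S_sum A l (x w) (c w) (a w)) \<in> borel_measurable N"
proof -
  have "(\<lambda>w. A (c w i) (inv_word (a w) (Suc i) (x w))) \<in> borel_measurable N" for i
  proof -
    have c_i: "(\<lambda>w. c w i) \<in> N \<rightarrow>\<^sub>M count_space {..<m}"
      by (rule measurable_compose[OF c bernoulli_component_measurable])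
    have "(\<lambda>w. A k (inv_word (a w) (Suc i) (x w))) \<in> borel_measurable N" if "k \<in> {..<m}" for k
      by (rule measurable_compose[OF inv_word_measurable[OF x a] A_measurable]) (use that in simp)
    from measurable_compose_countable'[OF this c_i countable_finite[OF finite_lessThan]]
    show ?thesis .
  qed
  then show ?thesis
    unfolding S_sum_def by (intro borel_measurable_suminf borel_measurable_times) simp_all
qed

lemma Psi_measurable: "Psi A l \<in> circle_lebesgue \<Otimes>\<^sub>M \<beta>2 \<Otimes>\<^sub>M \<beta> \<Otimes>\<^sub>M \<beta> \<rightarrow>\<^sub>M target"
proof -
  let ?N = "circle_lebesgue \<Otimes>\<^sub>M \<beta>2 \<Otimes>\<^sub>M \<beta> \<Otimes>\<^sub>M \<beta>"
  have x: "fst \<in> ?N \<rightarrow>\<^sub>M borel" by measurable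
  have a: "(\<lambda>w. fst (snd w)) \<in> ?N \<rightarrow>\<^sub>M \<beta>2" and c: "(\<lambda>w. fst (snd (snd w))) \<in> ?N \<rightarrow>\<^sub>M \<beta>"
    and b: "(\<lambda>w. snd (snd (snd w))) \<in> ?N \<rightarrow>\<^sub>M \<beta>" by measurable
  show ?thesis
    unfolding Psi_def split_beta
    by (intro measurable_Pair x b S_sum_measurable[OF x c a])
qed

lemma skew_measurable: "G \<in> target \<rightarrow>\<^sub>M target"
proof -
  have b: "(\<lambda>w. snd (snd w)) \<in> target \<rightarrow>\<^sub>M \<beta>" and x: "fst \<in> target \<rightarrow>\<^sub>M borel" by measurable
  have "(\<lambda>w. A (snd (snd w) 0) (fst w)) \<in> borel_measurable target"
  proof -
    have b_0: "(\<lambda>w. snd (snd w) 0) \<in> target \<rightarrow>\<^sub>M count_space {..<m}"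
      by (rule measurable_compose[OF b bernoulli_component_measurable])
    have "(\<lambda>w. A k (fst w)) \<in> borel_measurable target" if "k \<in> {..<m}" for k
      by (rule measurable_compose[OF x A_measurable]) (use that in simp)
    from measurable_compose_countable'[OF this b_0 countable_finite[OF finite_lessThan]]
    show ?thesis .
  qed
  then have "(\<lambda>w. A (snd (snd w) 0) (fst w) + l * fst (snd w)) \<in> borel_measurable target"
    by measurable
  moreover have "(\<lambda>w k. snd (snd w) (Suc k)) \<in> target \<rightarrow>\<^sub>M \<beta>"
    using b unfolding bernoulli_uniform_def by (rule measurable_tail_seq)
  moreover have "(\<lambda>w. doubling (fst w)) \<in> target \<rightarrow>\<^sub>M borel"
    by (rule measurable_compose[OF x doubling_measurable])
  ultimately show ?thesis
    unfolding skew_def split_beta by (intro measurable_Pair)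
qed

text \<open>
  The map \<open>\<Psi>\<close> with its arguments grouped as ((past of the circle point, circle point), (past
  letters, future letters)), the shape on which the product of the baker's map and the shift acts.
\<close>

definition \<Phi> :: "((nat \<Rightarrow> nat) \<times> circle) \<times> (nat \<Rightarrow> nat) \<times> (nat \<Rightarrow> nat) \<Rightarrow> circle \<times> real \<times> (nat \<Rightarrow> nat)" where
  "\<Phi> = (\<lambda>w. Psi A l (snd (fst w), fst (fst w), snd w))"

abbreviation "source \<equiv> (\<beta>2 \<Otimes>\<^sub>M circle_lebesgue) \<Otimes>\<^sub>M (\<beta> \<Otimes>\<^sub>M \<beta>)"

lemma \<Phi>_measurable: "\<Phi> \<in> source \<rightarrow>\<^sub>M target"
proof -
  have "(\<lambda>w. (snd (fst w), fst (fst w), snd w)) \<in> source \<rightarrow>\<^sub>M circle_lebesgue \<Otimes>\<^sub>M \<beta>2 \<Otimes>\<^sub>M \<beta> \<Otimes>\<^sub>M \<beta>" by measurable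
  from measurable_compose[OF this Psi_measurable] show ?thesis by (simp add: \<Phi>_def)
qed

lemma random_SRB_eq_distr: "\<mu> = distr source target \<Phi>"
proof -
  let ?h = "\<lambda>w. (snd (fst w), fst (fst w), snd w)"
  let ?N = "circle_lebesgue \<Otimes>\<^sub>M \<beta>2 \<Otimes>\<^sub>M \<beta> \<Otimes>\<^sub>M \<beta>"
  interpret \<beta>: prob_space \<beta> by (rule prob_space_bernoulli_uniform[OF m])
  interpret \<beta>2: prob_space \<beta>2 by (rule prob_space_bernoulli_uniform) simp
  interpret leb: prob_space circle_lebesgue by (rule prob_space_circle_lebesgue)
  interpret bb: pair_prob_space \<beta> \<beta> ..
  have h: "?h \<in> source \<rightarrow>\<^sub>M ?N" by measurable
  have "distr source ?N ?h = ?N"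
    by (rule distr_pair_swap_assoc) unfold_locales
  then have "\<mu> = distr (distr source ?N ?h) target (Psi A l)"
    by (simp add: random_SRB_def)
  also have "\<dots> = distr source target (Psi A l \<circ> ?h)"
    by (rule distr_distr[OF Psi_measurable h])
  also have "Psi A l \<circ> ?h = \<Phi>" by (auto simp: \<Phi>_def fun_eq_iff)
  finally show ?thesis .
qed

lemma prob_space_source: "prob_space source"
proof -
  interpret \<beta>: prob_space \<beta> by (rule prob_space_bernoulli_uniform[OF m])
  interpret \<beta>2: prob_space \<beta>2 by (rule prob_space_bernoulli_uniform) simp
  interpret leb: prob_space circle_lebesgue by (rule prob_space_circle_lebesgue)
  interpret bb: pair_prob_space \<beta> \<beta> ..
  interpret bl: pair_prob_space \<beta>2 circle_lebesgue ..
  interpret pair_prob_space "\<beta>2 \<Otimes>\<^sub>M circle_lebesgue" "\<beta> \<Otimes>\<^sub>M \<beta>" ..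
  show ?thesis by (rule prob_space_axioms)
qed

lemma prob_space_SRB: "prob_space \<mu>"
  unfolding random_SRB_eq_distr by (rule prob_space.prob_space_distr[OF prob_space_source \<Phi>_measurable])

lemma mixing_source: "mixing source (map_prod baker two_sided_shift)"
proof -
  interpret \<beta>: prob_space \<beta> by (rule prob_space_bernoulli_uniform[OF m])
  interpret \<beta>2: prob_space \<beta>2 by (rule prob_space_bernoulli_uniform) simp
  interpret leb: prob_space circle_lebesgue by (rule prob_space_circle_lebesgue)
  interpret bb: pair_prob_space \<beta> \<beta> ..
  interpret bl: pair_prob_space \<beta>2 circle_lebesgue ..
  show ?thesis
    by (rule mixing_product[OF bl.prob_space_axioms baker_mixing
          bb.prob_space_axioms two_sided_shift_bernoulli_mixing[OF m]])
qed

lemma \<Phi>_intertwines: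
  assumes "w \<in> space source"
  shows "\<Phi> (map_prod baker two_sided_shift w) = G (\<Phi> w)"
proof -
  obtain a x c b where w: "w = ((a, x), (c, b))" and c: "c \<in> space \<beta>" and b: "b \<in> space \<beta>"
    using assms by (auto simp: space_pair_measure)
  have "b 0 < m" using b by (simp add: space_\<beta>_iff)
  from S_sum_doubling[OF c this] show ?thesis
    by (simp add: w \<Phi>_def Psi_def skew_def baker_def two_sided_shift_def)
qed

theorem skew_mixing: "mixing \<mu> G"
  unfolding random_SRB_eq_distr
  by (rule mixing_factor[OF mixing_source \<Phi>_measurable skew_measurable \<Phi>_intertwines])

lemma skew_ergodic: "ergodic \<mu> G"
  by (rule ergodic_if_mixing[OF skew_mixing])

text \<open>
  The radius is the bound for the geometric series defining the fibre coordinate; it is also the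
  fixed point of \<open>R \<mapsto> C + l * R\<close>, whence the set is forward invariant.
\<close>

definition attractor :: "(circle \<times> real \<times> (nat \<Rightarrow> nat)) set" where
  "attractor = UNIV \<times> {- (C / (1 - l))..C / (1 - l)} \<times> space \<beta>"

lemma space_SRB: "space \<mu> = UNIV \<times> UNIV \<times> space \<beta>"
  by (simp add: random_SRB_def space_pair_measure)

lemma sets_SRB: "sets \<mu> = sets target"
  by (simp add: random_SRB_def)

lemma attractor_sets: "attractor \<in> sets \<mu>"
  unfolding sets_SRB attractor_def by (intro pair_measureI) auto

lemma skew_attractor:
  assumes "w \<in> attractor"
  shows "G w \<in> attractor"
proof -
  obtain x y b where w: "w = (x, y, b)" "\<bar>y\<bar> \<le> C / (1 - l)" "b \<in> space \<beta>"
    using assms by (auto simp: attractor_def abs_le_iff)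
  have "\<bar>A (b 0) x + l * y\<bar> \<le> \<bar>A (b 0) x\<bar> + l * \<bar>y\<bar>"
    using l abs_triangle_ineq[of "A (b 0) x" "l * y"] by (simp add: abs_mult)
  also have "\<dots> \<le> C + l * (C / (1 - l))"
    using A_bound[of "b 0" x] w l by (intro add_mono mult_left_mono) (auto simp: space_\<beta>_iff)
  also have "\<dots> = C / (1 - l)" using l by (simp add: field_simps)
  finally show ?thesis
    using w(3) by (auto simp: w attractor_def skew_def space_\<beta>_iff abs_le_iff)
qed

lemma skew_funpow_attractor: "w \<in> attractor \<Longrightarrow> (G ^^ n) w \<in> attractor"
  by (induction n) (simp_all add: skew_attractor)

lemma AE_attractor: "AE w in \<mu>. w \<in> attractor"
proof -
  have "{w \<in> space target. w \<in> attractor} \<in> sets target"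
    using attractor_sets sets.sets_into_space[OF attractor_sets] by (simp add: sets_SRB space_SRB Int_absorb1 Collect_mem_eq space_pair_measure Int_def[symmetric])
  then show ?thesis
    unfolding random_SRB_eq_distr
  proof (subst AE_distr_iff[OF \<Phi>_measurable])
    show "AE w in source. \<Phi> w \<in> attractor"
      using AE_space
    proof eventually_elim
      fix w assume "w \<in> space source"
      then obtain a x c b where w: "w = ((a, x), (c, b))" and c: "c \<in> space \<beta>" and b: "b \<in> space \<beta>"
        by (auto simp: space_pair_measure)
      show "\<Phi> w \<in> attractor"
        using S_sum_bound[OF c, of x a] b by (auto simp: w \<Phi>_def Psi_def attractor_def abs_le_iff)
    qed
  qed
qed

end

section \<open>Birkhoff averages of all continuous functions at once\<close>

lemma tendsto_fun_iff:
  fixes f :: "'c \<Rightarrow> 'a \<Rightarrow> 'b::topological_space"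
  shows "(f \<longlongrightarrow> v) F \<longleftrightarrow> (\<forall>i. ((\<lambda>k. f k i) \<longlongrightarrow> v i) F)"
  using limitin_componentwise[of "\<lambda>_. euclidean" UNIV f v F]
  by (simp add: euclidean_product_topology)

lemma tendsto_of_close:
  fixes p q :: "nat \<Rightarrow> 'a::metric_space"
  assumes p: "p \<longlonglongrightarrow> v" and close: "\<And>k. dist (q k) (p k) \<le> 1 / real (Suc k)"
  shows "q \<longlonglongrightarrow> v"
  unfolding tendsto_dist_iff[of q]
proof (rule tendsto_sandwich[of "\<lambda>_. 0" _ _ "\<lambda>k. 1 / real (Suc k) + dist (p k) v"])
  have "(\<lambda>k. 1 / real (Suc k) + dist (p k) v) \<longlonglongrightarrow> 0 + 0"
    by (intro tendsto_add LIMSEQ_Suc[OF lim_1_over_n] tendsto_dist_iff[THEN iffD1, OF p])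
  then show "(\<lambda>k. 1 / real (Suc k) + dist (p k) v) \<longlonglongrightarrow> 0" by simp
  have "dist (q k) v \<le> 1 / real (Suc k) + dist (p k) v" for k
    using dist_triangle[of "q k" v "p k"] close[of k] by linarith
  then show "\<forall>\<^sub>F k in sequentially. dist (q k) v \<le> 1 / real (Suc k) + dist (p k) v" by simp
qed simp_all

lemma abs_diff_of_floor_eq:
  assumes "\<lfloor>real (Suc n) * a\<rfloor> = \<lfloor>real (Suc n) * b\<rfloor>"
  shows "\<bar>a - b\<bar> \<le> 1 / real (Suc n)"
proof -
  have "\<bar>real (Suc n) * a - real (Suc n) * b\<bar> < 1" using assms by linarith
  then have "real (Suc n) * \<bar>a - b\<bar> < 1" by (simp add: right_diff_distrib[symmetric] abs_mult)
  then show ?thesis by (simp add: field_simps)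
qed

text \<open>
  The label of the cell of level \<open>n\<close> that contains a point.  Labels form a countable type, so a
  statement about every cell of every level costs only countably many null sets.  The scale is
  \<open>1 / Suc n\<close> so that level \<open>0\<close> is not degenerate.
\<close>

definition cell :: "nat \<Rightarrow> circle \<times> real \<times> (nat \<Rightarrow> nat) \<Rightarrow> int \<times> int \<times> nat list" where
  "cell n = (\<lambda>(x, y, b). (\<lfloor>real (Suc n) * circle_rep x\<rfloor>, \<lfloor>real (Suc n) * y\<rfloor>, map b [0..<Suc n]))"

lemma cell_eqD:
  assumes "cell n (x, y, b) = cell n (x', y', b')"
  shows "dist x x' \<le> 1 / real (Suc n)" "dist y y' \<le> 1 / real (Suc n)" "i \<le> n \<Longrightarrow> b i = b' i"
proof -
  have e: "\<lfloor>real (Suc n) * circle_rep x\<rfloor> = \<lfloor>real (Suc n) * circle_rep x'\<rfloor>"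
    "\<lfloor>real (Suc n) * y\<rfloor> = \<lfloor>real (Suc n) * y'\<rfloor>" "map b [0..<Suc n] = map b' [0..<Suc n]"
    using assms by (simp_all only: cell_def prod.case prod.inject)
  show "dist x x' \<le> 1 / real (Suc n)"
    by (rule order_trans[OF dist_circle_le_rep abs_diff_of_floor_eq[OF e(1)]])
  show "dist y y' \<le> 1 / real (Suc n)"
    unfolding dist_real_def by (rule abs_diff_of_floor_eq[OF e(2)])
  assume "i \<le> n"
  then have "i \<in> set [0..<Suc n]" by (simp only: set_upt atLeastLessThan_iff le_imp_less_Suc zero_le simp_thms)
  then show "b i = b' i" using e(3) unfolding map_eq_conv by blast
qed

text \<open>
  Points that share a cell of level \<open>r k \<ge> k\<close> have the same limit: real coordinates differ by at most
  \<open>1 / Suc k\<close>, and each letter agrees eventually.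
\<close>

lemma tendsto_of_same_cells:
  assumes p: "p \<longlonglongrightarrow> v" and cell: "\<And>k. cell (r k) (p k) = cell (r k) (q k)" and r: "\<And>k. k \<le> r k"
  shows "q \<longlonglongrightarrow> v"
proof -
  obtain x y b where v: "v = (x, y, b)" by (cases v)
  have le: "1 / real (Suc (r k)) \<le> 1 / real (Suc k)" for k using r[of k] by (intro divide_left_mono) auto
  have c: "cell (r k) (fst (q k), fst (snd (q k)), snd (snd (q k))) = cell (r k) (fst (p k), fst (snd (p k)), snd (snd (p k)))" for k
    by (simp add: cell)
  have "(\<lambda>k. fst (p k)) \<longlonglongrightarrow> x" using tendsto_fst[OF p] by (simp add: v)
  then have 1: "(\<lambda>k. fst (q k)) \<longlonglongrightarrow> x"
    by (rule tendsto_of_close) (rule order_trans[OF cell_eqD(1)[OF c] le])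
  have "(\<lambda>k. fst (snd (p k))) \<longlonglongrightarrow> y" using tendsto_fst[OF tendsto_snd[OF p]] by (simp add: v)
  then have 2: "(\<lambda>k. fst (snd (q k))) \<longlonglongrightarrow> y"
    by (rule tendsto_of_close) (rule order_trans[OF cell_eqD(2)[OF c] le])
  have "(\<lambda>k. snd (snd (p k))) \<longlonglongrightarrow> b" using tendsto_snd[OF tendsto_snd[OF p]] by (simp add: v)
  then have "(\<lambda>k. snd (snd (p k)) i) \<longlonglongrightarrow> b i" for i by (simp add: tendsto_fun_iff)
  moreover have "\<forall>\<^sub>F k in sequentially. snd (snd (p k)) i = snd (snd (q k)) i" for i
    by (rule eventually_sequentiallyI[of i]) (rule cell_eqD(3)[OF c, symmetric], rule order_trans[OF _ r])
  ultimately have "(\<lambda>k. snd (snd (q k)) i) \<longlonglongrightarrow> b i" for i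
    by (rule Lim_transform_eventually)
  then have "(\<lambda>k. snd (snd (q k))) \<longlonglongrightarrow> b" by (simp add: tendsto_fun_iff)
  with 1 2 have "(\<lambda>k. (fst (q k), fst (snd (q k)), snd (snd (q k)))) \<longlonglongrightarrow> (x, y, b)"
    by (intro tendsto_Pair)
  then show ?thesis by (simp add: v)
qed

lemma birkhoff_avg_sum:
  "birkhoff_avg f (\<lambda>w. \<Sum>q\<in>Q. c q * h q w) N w = (\<Sum>q\<in>Q. c q * birkhoff_avg f (h q) N w)"
proof -
  have "(\<Sum>j<N. \<Sum>q\<in>Q. c q * h q ((f ^^ j) w)) = (\<Sum>q\<in>Q. c q * (\<Sum>j<N. h q ((f ^^ j) w)))"
    by (subst sum.swap) (simp add: sum_distrib_left)
  then show ?thesis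
    by (simp add: birkhoff_avg_def sum_distrib_left mult.left_commute)
qed

lemma birkhoff_avg_close:
  assumes "\<And>j. \<bar>g ((f ^^ j) w) - h ((f ^^ j) w)\<bar> \<le> e" "0 \<le> e"
  shows "\<bar>birkhoff_avg f g N w - birkhoff_avg f h N w\<bar> \<le> e"
proof (cases "N = 0")
  case False
  have "\<bar>\<Sum>j<N. g ((f ^^ j) w) - h ((f ^^ j) w)\<bar> \<le> (\<Sum>j<N. e)"
    by (rule order_trans[OF sum_abs sum_mono]) (rule assms(1))
  then have "\<bar>\<Sum>j<N. g ((f ^^ j) w) - h ((f ^^ j) w)\<bar> \<le> real N * e" by simp
  moreover have "birkhoff_avg f g N w - birkhoff_avg f h N w
      = (\<Sum>j<N. g ((f ^^ j) w) - h ((f ^^ j) w)) / real N"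
    by (simp add: birkhoff_avg_def sum_subtractf diff_divide_distrib)
  ultimately show ?thesis using False by (simp add: pos_divide_le_eq mult.commute)
qed (use assms in \<open>simp add: birkhoff_avg_def\<close>)

context random_skew
begin

lemma word_measurable: "(\<lambda>w. map (snd (snd w)) [0..<n]) \<in> target \<rightarrow>\<^sub>M count_space UNIV"
proof (induction n)
  case 0
  show ?case by simp
next
  case (Suc n)
  have "(\<lambda>w. snd (snd w) n) \<in> target \<rightarrow>\<^sub>M count_space {..<m}"
    by (rule measurable_compose[OF _ bernoulli_component_measurable]) measurable
  then have "(\<lambda>w. xs @ [snd (snd w) n]) \<in> target \<rightarrow>\<^sub>M count_space UNIV" for xs
    by (rule measurable_compose) simp
  from measurable_compose_countable[OF this Suc] show ?case by simp
qed

lemma cell_sets: "{w \<in> space \<mu>. cell n w = q} \<in> sets \<mu>"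
proof -
  obtain i j bs where q: "q = (i, j, bs)" by (cases q)
  have ev: "{w \<in> space target. h w = v} \<in> sets target"
    if "h \<in> target \<rightarrow>\<^sub>M count_space UNIV" for h :: "_ \<Rightarrow> 'z" and v
    using measurable_sets[OF that, of "{v}"] by (simp add: vimage_def Int_def conj_commute)
  have "(\<lambda>w. \<lfloor>real (Suc n) * circle_rep (fst w)\<rfloor>) \<in> target \<rightarrow>\<^sub>M count_space UNIV"
    "(\<lambda>w. \<lfloor>real (Suc n) * fst (snd w)\<rfloor>) \<in> target \<rightarrow>\<^sub>M count_space UNIV" by measurable
  from ev[OF this(1), of i] ev[OF this(2), of j] ev[OF word_measurable[of "Suc n"], of bs]
  have "{w \<in> space target. \<lfloor>real (Suc n) * circle_rep (fst w)\<rfloor> = i \<and> \<lfloor>real (Suc n) * fst (snd w)\<rfloor> = j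
      \<and> map (snd (snd w)) [0..<Suc n] = bs} \<in> sets target"
    by (intro sets.sets_Collect_conj)
  moreover have "space \<mu> = space target" by (simp add: random_SRB_def)
  moreover have "cell n w = q \<longleftrightarrow> \<lfloor>real (Suc n) * circle_rep (fst w)\<rfloor> = i \<and> \<lfloor>real (Suc n) * fst (snd w)\<rfloor> = j
      \<and> map (snd (snd w)) [0..<Suc n] = bs" for w
    by (simp only: cell_def q split_beta prod.inject)
  ultimately show ?thesis by (simp only: sets_SRB)
qed

lemma compact_attractor: "compact attractor"
proof -
  have "compactin (product_topology (\<lambda>_. euclidean) UNIV) (Pi\<^sub>E UNIV (\<lambda>_::nat. {..<m}))"
    unfolding compactin_PiE by (simp add: finite_imp_compact)
  then have "compact (Pi\<^sub>E UNIV (\<lambda>_::nat. {..<m}))" by (simp add: euclidean_product_topology)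
  moreover have "Pi\<^sub>E UNIV (\<lambda>_. {..<m}) = space \<beta>"
    by (simp add: bernoulli_uniform_def space_PiM space_uniform_count_measure)
  ultimately show ?thesis
    unfolding attractor_def by (intro compact_Times compact_UNIV_circle compact_Icc) simp
qed

lemma finite_cells: "finite (cell n ` attractor)"
proof (rule finite_subset)
  let ?R = "C / (1 - l)"
  let ?I = "{0..\<lfloor>real (Suc n)\<rfloor>}" and ?J = "{\<lfloor>real (Suc n) * - ?R\<rfloor>..\<lfloor>real (Suc n) * ?R\<rfloor>}"
  let ?W = "{bs. set bs \<subseteq> {..<m} \<and> length bs = Suc n}"
  show "finite (?I \<times> ?J \<times> ?W)"
    by (intro finite_cartesian_product finite_atLeastAtMost_int finite_lists_length_eq finite_lessThan)
  show "cell n ` attractor \<subseteq> ?I \<times> ?J \<times> ?W"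
  proof
    fix q assume "q \<in> cell n ` attractor"
    then obtain x y b where q: "q = cell n (x, y, b)" and y: "- ?R \<le> y" "y \<le> ?R" and b: "b \<in> space \<beta>"
      by (auto simp: attractor_def)
    have "\<lfloor>real (Suc n) * circle_rep x\<rfloor> \<in> ?I"
    proof -
      have "real (Suc n) * circle_rep x \<le> real (Suc n) * 1"
        using circle_rep_bounds(2)[of x] by (intro mult_left_mono) auto
      then have "\<lfloor>real (Suc n) * circle_rep x\<rfloor> \<le> \<lfloor>real (Suc n)\<rfloor>" by (intro floor_mono) simp
      moreover have "0 \<le> real (Suc n) * circle_rep x"
        using circle_rep_bounds(1)[of x] by (intro mult_nonneg_nonneg) auto
      ultimately show ?thesis by (simp only: atLeastAtMost_iff zero_le_floor simp_thms)
    qed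
    moreover have "\<lfloor>real (Suc n) * y\<rfloor> \<in> ?J"
      unfolding atLeastAtMost_iff using y by (intro conjI floor_mono mult_left_mono) auto
    moreover have "map b [0..<Suc n] \<in> ?W" using b by (auto simp: space_\<beta>_iff)
    ultimately show "q \<in> ?I \<times> ?J \<times> ?W" unfolding q cell_def prod.case by blast
  qed
qed

text \<open>
  Uniform continuity in terms of cells.  Otherwise there would be, at each level, two points of the
  attractor in a common cell with values at distance at least \<open>e\<close>; by compactness a subsequence of
  the first points converges, hence so does that of the second points, and to the same limit.
\<close>

lemma oscillation_on_cells:
  assumes g: "continuous_on (space \<mu>) g" and e: "0 < e"
  obtains n where "\<And>w w'. w \<in> attractor \<Longrightarrow> w' \<in> attractor \<Longrightarrow> cell n w = cell n w' \<Longrightarrow> \<bar>g w - g w'\<bar> < (e :: real)"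
proof (rule ccontr)
  assume no: "\<not> thesis"
  have "\<exists>p q. p \<in> attractor \<and> q \<in> attractor \<and> cell n p = cell n q \<and> e \<le> \<bar>g p - g q\<bar>" for n
  proof (rule ccontr)
    assume none: "\<not> (\<exists>p q. p \<in> attractor \<and> q \<in> attractor \<and> cell n p = cell n q \<and> e \<le> \<bar>g p - g q\<bar>)"
    have thesis
    proof (rule that[of n])
      fix w w' assume "w \<in> attractor" "w' \<in> attractor" "cell n w = cell n w'"
      with none have "\<not> e \<le> \<bar>g w - g w'\<bar>" by blast
      then show "\<bar>g w - g w'\<bar> < e" by simp
    qed
    with no show False by contradiction
  qed
  then obtain p q where pq: "\<And>n. p n \<in> attractor" "\<And>n. q n \<in> attractor"
    "\<And>n. cell n (p n) = cell n (q n)" "\<And>n. e \<le> \<bar>g (p n) - g (q n)\<bar>"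
    by metis
  from compact_imp_seq_compact[OF compact_attractor] pq(1)
  obtain v r where v: "v \<in> attractor" and r: "strict_mono r" and pv: "(p \<circ> r) \<longlonglongrightarrow> v"
    unfolding seq_compact_def by metis
  have pv: "(\<lambda>k. p (r k)) \<longlonglongrightarrow> v" using pv by (simp add: o_def)
  have qv: "(\<lambda>k. q (r k)) \<longlonglongrightarrow> v"
    by (rule tendsto_of_same_cells[OF pv pq(3) seq_suble[OF r]])
  have sub: "attractor \<subseteq> space \<mu>" by (rule sets.sets_into_space[OF attractor_sets])
  have "(\<lambda>k. g (s k)) \<longlonglongrightarrow> g v" if "s \<longlonglongrightarrow> v" "\<And>k. s k \<in> attractor" for s
    by (rule continuous_on_tendsto_compose[OF g that(1)]) (use v that(2) sub in \<open>auto intro: always_eventually\<close>)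
  from tendsto_diff[OF this[OF pv pq(1)] this[OF qv pq(2)]]
  have "(\<lambda>k. \<bar>g (p (r k)) - g (q (r k))\<bar>) \<longlonglongrightarrow> \<bar>g v - g v\<bar>" by (rule tendsto_rabs)
  then have "e \<le> \<bar>g v - g v\<bar>" by (rule LIMSEQ_le_const) (use pq(4) in blast)
  then show False using e by simp
qed

text \<open>
  Countably many conditions, each of full measure, and none of them mentions the function to be
  averaged: this is why one exceptional set can serve all continuous functions.
\<close>

definition generic :: "(circle \<times> real \<times> (nat \<Rightarrow> nat)) \<Rightarrow> bool" where
  "generic w \<longleftrightarrow> w \<in> attractor \<and> (\<forall>n q.
    (\<lambda>N. birkhoff_avg G (indicator {w \<in> space \<mu>. cell n w = q}) N w) \<longlonglongrightarrow> measure \<mu> {w \<in> space \<mu>. cell n w = q})"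

lemma AE_generic: "AE w in \<mu>. generic w"
proof -
  interpret prob_space \<mu> by (rule prob_space_SRB)
  have "AE w in \<mu>. (\<lambda>N. birkhoff_avg G (indicator {w \<in> space \<mu>. cell n w = q}) N w)
      \<longlonglongrightarrow> measure \<mu> {w \<in> space \<mu>. cell n w = q}" for n q
  proof -
    let ?E = "{w \<in> space \<mu>. cell n w = q}"
    have "integrable \<mu> (indicator ?E :: _ \<Rightarrow> real)"
      using cell_sets[of n q] by (simp add: integrable_indicator_iff emeasure_eq_measure)
    moreover have "integral\<^sup>L \<mu> (indicator ?E) = measure \<mu> ?E"
      using sets.sets_into_space[OF cell_sets[of n q]] by (simp add: Int_absorb2)
    ultimately show ?thesis using birkhoff_ergodic[OF skew_ergodic, of "indicator ?E"] by simp
  qed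
  then have "AE w in \<mu>. \<forall>n q. (\<lambda>N. birkhoff_avg G (indicator {w \<in> space \<mu>. cell n w = q}) N w)
      \<longlonglongrightarrow> measure \<mu> {w \<in> space \<mu>. cell n w = q}"
    unfolding AE_all_countable by blast
  with AE_attractor show ?thesis by eventually_elim (simp add: generic_def)
qed

text \<open>
  Let \<open>h\<close> take, on each cell, the value of \<open>g\<close> at some point of the attractor in that cell.
  The averages of \<open>h\<close> converge at generic points by linearity, and \<open>h\<close> is uniformly close
  to \<open>g\<close> along the orbit as well as in the mean, so the averages of \<open>g\<close> converge.
\<close>

theorem birkhoff_continuous:
  assumes w: "generic w" and g: "integrable \<mu> g" "continuous_on (space \<mu>) g"
  shows "(\<lambda>N. birkhoff_avg G g N w) \<longlonglongrightarrow> integral\<^sup>L \<mu> g"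
proof (rule tendstoI)
  interpret prob_space \<mu> by (rule prob_space_SRB)
  fix e :: real assume "0 < e"
  \<comment> \<open>Three errors of size \<open>d\<close> will add up: along the orbit, in the mean, and in the averages of \<open>h\<close>.\<close>
  define d where "d = e / 4"
  have d: "0 < d" using \<open>0 < e\<close> by (simp add: d_def)
  obtain n where osc: "\<And>v v'. v \<in> attractor \<Longrightarrow> v' \<in> attractor \<Longrightarrow> cell n v = cell n v' \<Longrightarrow> \<bar>g v - g v'\<bar> < d"
    using oscillation_on_cells[OF g(2) d] by blast
  let ?Q = "cell n ` attractor"
  let ?E = "\<lambda>q. {v \<in> space \<mu>. cell n v = q}"
  obtain s where s: "\<And>q. q \<in> ?Q \<Longrightarrow> s q \<in> attractor \<and> cell n (s q) = q"
    using bchoice[of ?Q "\<lambda>q v. v \<in> attractor \<and> cell n v = q"] by blast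
  define h where "h = (\<lambda>v. \<Sum>q\<in>?Q. g (s q) * indicator (?E q) v)"
  have h_eq: "h v = g (s (cell n v))" if v: "v \<in> attractor" for v
  proof -
    have "v \<in> space \<mu>" using sets.sets_into_space[OF attractor_sets] v by blast
    then have "h v = (\<Sum>q\<in>?Q. if q = cell n v then g (s q) else 0)"
      unfolding h_def by (intro sum.cong) (auto simp: indicator_def)
    also have "\<dots> = g (s (cell n v))" using v finite_cells by (simp add: sum.delta)
    finally show ?thesis .
  qed
  have close: "\<bar>g v - h v\<bar> \<le> d" if v: "v \<in> attractor" for v
    unfolding h_eq[OF v] using osc[OF v, of "s (cell n v)"] s[of "cell n v"] v by fastforce
  have int: "integrable \<mu> (\<lambda>v. g (s q) * indicator (?E q) v :: real)" for q
    using cell_sets[of n q] by (intro integrable_mult_right) (simp add: integrable_indicator_iff emeasure_eq_measure)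
  have h_int: "integrable \<mu> h" unfolding h_def by (rule Bochner_Integration.integrable_sum) (rule int)
  have int_ind: "(\<integral>v. g (s q) * indicator (?E q) v \<partial>\<mu>) = g (s q) * measure \<mu> (?E q)" for q
    using sets.sets_into_space[OF cell_sets[of n q]] by (simp add: Int_absorb2)
  have h_integral: "integral\<^sup>L \<mu> h = (\<Sum>q\<in>?Q. g (s q) * measure \<mu> (?E q))"
    unfolding h_def Bochner_Integration.integral_sum[OF int] int_ind ..
  have conv: "(\<lambda>N. birkhoff_avg G (indicator (?E q)) N w) \<longlonglongrightarrow> measure \<mu> (?E q)" for q
    using w unfolding generic_def by blast
  have "(\<lambda>N. \<Sum>q\<in>?Q. g (s q) * birkhoff_avg G (indicator (?E q)) N w) \<longlonglongrightarrow> integral\<^sup>L \<mu> h"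
    unfolding h_integral by (intro tendsto_sum tendsto_mult tendsto_const conv)
  then have "(\<lambda>N. birkhoff_avg G h N w) \<longlonglongrightarrow> integral\<^sup>L \<mu> h"
    unfolding h_def birkhoff_avg_sum .
  from tendstoD[OF this d]
  show "\<forall>\<^sub>F N in sequentially. dist (birkhoff_avg G g N w) (integral\<^sup>L \<mu> g) < e"
  proof eventually_elim
    fix N assume N: "dist (birkhoff_avg G h N w) (integral\<^sup>L \<mu> h) < d"
    have "\<bar>birkhoff_avg G g N w - birkhoff_avg G h N w\<bar> \<le> d"
      by (rule birkhoff_avg_close[OF close]) (use w d skew_funpow_attractor in \<open>auto simp: generic_def\<close>)
    moreover have "\<bar>integral\<^sup>L \<mu> g - integral\<^sup>L \<mu> h\<bar> \<le> d"
    proof -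
      have "integral\<^sup>L \<mu> g - integral\<^sup>L \<mu> h = (\<integral>v. g v - h v \<partial>\<mu>)" using g(1) h_int by simp
      also have "\<bar>\<dots>\<bar> \<le> (\<integral>v. \<bar>g v - h v\<bar> \<partial>\<mu>)" by (rule integral_abs_bound)
      also have "\<dots> \<le> (\<integral>v. d \<partial>\<mu>)"
        using g(1) h_int AE_attractor close by (intro integral_mono_AE) auto
      finally show ?thesis by (simp add: prob_space)
    qed
    ultimately show "dist (birkhoff_avg G g N w) (integral\<^sup>L \<mu> g) < e"
      using N d unfolding dist_real_def d_def by linarith
  qed
qed

end

section \<open>Ergodicity of the random SRB measure\<close>

lemma (in prob_space) AE_full_event:
  assumes "AE w in M. P w"
  shows "\<exists>\<Omega>\<in>events. prob \<Omega> = 1 \<and> (\<forall>w\<in>\<Omega>. P w)"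
proof -
  obtain \<Omega> where "{w \<in> space M. P w} \<supseteq> \<Omega>" "\<Omega> \<in> events" "prob \<Omega> = 1"
    using AE_E_prob[OF assms] by auto
  then show ?thesis by blast
qed

text \<open>
  Lipschitz functions on the compact circle are bounded, and there are only finitely many of them.
\<close>

lemma random_skew_lipschitz:
  assumes "m \<ge> 2" "0 < l" "l < 1" and lip: "\<And>c. c < m \<Longrightarrow> \<exists>L. L-lipschitz_on UNIV (A c)"
  shows "\<exists>C. random_skew m l A C"
proof -
  have cont: "continuous_on UNIV (A c)" if "c < m" for c
    using lip[OF that] lipschitz_on_continuous_on by blast
  have "bounded (\<Union>c\<in>{..<m}. range (A c))"
  proof (rule bounded_UN[OF finite_lessThan], intro ballI)
    fix c assume "c \<in> {..<m}"
    then show "bounded (range (A c))"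
      by (intro compact_imp_bounded compact_continuous_image cont compact_UNIV_circle) simp
  qed
  then obtain C where C: "\<forall>y\<in>(\<Union>c\<in>{..<m}. range (A c)). norm y \<le> C" unfolding bounded_iff by blast
  have "random_skew m l A C"
  proof
    show "A c \<in> borel_measurable borel" if "c < m" for c
      by (rule borel_measurable_continuous_onI[OF cont[OF that]])
    show "\<bar>A c x\<bar> \<le> C" if "c < m" for c x
    proof -
      have "A c x \<in> (\<Union>c\<in>{..<m}. range (A c))" using that by blast
      with C have "norm (A c x) \<le> C" by blast
      then show ?thesis by simp
    qed
  qed (use assms in auto)
  then show ?thesis ..
qed

theorem theorem2p12:
  fixes m :: nat and l :: real and A :: "nat \<Rightarrow> circle \<Rightarrow> real"
  assumes "m \<ge> 2" and "0 < l" and "l < 1"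
    and "\<And>c. c < m \<Longrightarrow> \<exists>L. L-lipschitz_on UNIV (A c)"
  defines "\<mu> \<equiv> random_SRB m A l" and "G \<equiv> skew A l"
  shows "prob_space \<mu> \<and> ergodic \<mu> G \<and>
    (\<forall>g. integrable \<mu> g \<longrightarrow>
      (\<exists>\<Omega>\<in>sets \<mu>. measure \<mu> \<Omega> = 1 \<and>
        (\<forall>w\<in>\<Omega>. (\<lambda>N. birkhoff_avg G g N w) \<longlonglongrightarrow> integral\<^sup>L \<mu> g))) \<and>
    (\<exists>\<Omega>\<in>sets \<mu>. measure \<mu> \<Omega> = 1 \<and>
      (\<forall>w\<in>\<Omega>. \<forall>g. integrable \<mu> g \<and> continuous_on (space \<mu>) g \<longrightarrow>
        (\<lambda>N. birkhoff_avg G g N w) \<longlonglongrightarrow> integral\<^sup>L \<mu> g))"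
proof -
  have "\<exists>C. random_skew m l A C" by (rule random_skew_lipschitz[OF assms(1-3)]) (rule assms(4))
  then obtain C where "random_skew m l A C" ..
  then interpret random_skew m l A C .
  have prob: "prob_space \<mu>" and erg: "ergodic \<mu> G"
    unfolding \<mu>_def G_def by (rule prob_space_SRB, rule skew_ergodic)
  note full = prob_space.AE_full_event[OF prob]
  have "\<exists>\<Omega>\<in>sets \<mu>. measure \<mu> \<Omega> = 1 \<and> (\<forall>w\<in>\<Omega>. (\<lambda>N. birkhoff_avg G g N w) \<longlonglongrightarrow> integral\<^sup>L \<mu> g)"
    if "integrable \<mu> g" for g
    by (rule full[OF prob_space.birkhoff_ergodic[OF prob erg that]])
  moreover have "\<exists>\<Omega>\<in>sets \<mu>. measure \<mu> \<Omega> = 1 \<and>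
      (\<forall>w\<in>\<Omega>. \<forall>g. integrable \<mu> g \<and> continuous_on (space \<mu>) g \<longrightarrow>
        (\<lambda>N. birkhoff_avg G g N w) \<longlonglongrightarrow> integral\<^sup>L \<mu> g)"
  proof (rule full)
    show "AE w in \<mu>. \<forall>g. integrable \<mu> g \<and> continuous_on (space \<mu>) g \<longrightarrow>
        (\<lambda>N. birkhoff_avg G g N w) \<longlonglongrightarrow> integral\<^sup>L \<mu> g"
      unfolding \<mu>_def G_def using AE_generic by eventually_elim (blast intro: birkhoff_continuous)
  qed
  ultimately show ?thesis using prob erg by blast
qed

end
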